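(* Let $p>3$ be a prime, let $q\ge 3$ be an integer with $|q|_p=|q-1|_p=|2q-1|_p=1$, and let $\rho\in\mathcal{E}_p$ satisfy $|\rho-1|_p\le p^{-3}$ and $|\rho-1|_p<|4q-3|_p$. Let $a_0,b_0\in\{1,\dots,p-1\}$ be given by $a_0\equiv 3(q-1)\pmod p$, $b_0\equiv 2(q-1)(2q-1)\pmod p$, put $D_0=-4a_0^3-27b_0^2$, and let $u_{n+3}=b_0u_n-a_0u_{n+1}$ ($n\ge1$) with $u_1=0$, $u_2=-a_0$, $u_3=b_0$. Assume that one of the following conditions is satisfied: (a) $|4q-3|_p=1$ and $u_{p-2}\equiv0\pmod p$; (b) $|4q-3|_p=p^{-2k}$ for some $k\ge1$, and $-108q(q-1)^2(4q-3)p^{-2k}$ is a quadratic residue modulo $p$; (c) $D_0u_{p-2}^2\not\equiv0\pmod p$ and $D_0u_{p-2}^2\not\equiv9a_0^2\pmod p$; (d) $|4q-3|_p=p^{-(2k+1)}$ for some $k\ge0$; (e) $|4q-3|_p=p^{-2k}$ for some $k\ge1$, and $-108q(q-1)^2(4q-3)p^{-2k}$ is not a quadratic residue modulo $p$; so that for the $q$-state $p$-adic Potts model on the Cayley tree of order three there is at least one translation-invariant generalized $p$-adic quasi Gibbs measure $\tilde\mu$ corresponding to a root $\tilde x\in\mathbb{Q}_p$ of $x^3-Ax^2-Bx+C=0$. Let $\mu_0$ be the $p$-adic Gibbs measure corresponding to the solution $x_0=1$. Then $\mu_0$ is bounded and $\tilde\mu$ is unbounded. In particular, there is a phase transition.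
   Context: $\mathbb{Q}_p$ is the field of $p$-adic numbers with norm $|\cdot|_p$, $|p|_p=1/p$. $\mathcal{E}_p=\{x\in\mathbb{Q}_p: |x|_p=1,\ |x-1|_p<p^{-1/(p-1)}\}$. Tree. $\Gamma^3_+=(V,L)$ is the semi-infinite Cayley tree of order three with root $x^0$: the infinite rooted tree in which every vertex has exactly three direct successors. $W_n$ is the set of vertices at distance $n$ from $x^0$, $V_n=\bigcup_{m=0}^n W_m$, and $L_n$ is the set of edges $\langle x,y\rangle$ with $x,y\in V_n$. Potts model. The state space is $\Phi=\{0,1,\dots,q-1\}$, and $\Omega=\Phi^V$, $\Omega_{V_n}=\Phi^{V_n}$, $\Omega_{W_n}=\Phi^{W_n}$. The Hamiltonian is $H_n(\sigma)=\sum_{\langle x,y\rangle\in L_n}\delta_{\sigma(x),\sigma(y)}$ for $\sigma\in\Omega_{V_n}$ ($\delta$ is the Kronecker symbol). Measures. A $p$-adic (probability) measure is a finitely additive $\mathbb{Q}_p$-valued function $\mu$ on an algebra $\mathcal{B}$ of sets (with total mass $1$); it is bounded if $\sup\{|\mu(A)|_p:A\in\mathcal{B}\}<\infty$ and unbounded otherwise. Given $\rho\in\mathbb{Q}_p$ and a function $\mathbf{h}:V\setminus\{x^0\}\to\mathbb{Q}_p^{\Phi}$, $\mathbf{h}_x=(h_{0,x},\dots,h_{q-1,x})$, normalized (without loss of generality) by $h_{0,x}=1$, define for $n\ge 1$ and $\sigma\in\Omega_{V_n}$ $$\mu^{(n)}_{\mathbf{h},\rho}(\sigma)=\frac{1}{Z^{(\mathbf{h})}_{n,\rho}}\,\rho^{H_n(\sigma)}\prod_{x\in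 W_n}h_{\sigma(x),x},\qquad Z^{(\mathbf{h})}_{n,\rho}=\sum_{\sigma\in\Omega_{V_n}}\rho^{H_n(\sigma)}\prod_{x\in W_n}h_{\sigma(x),x}.$$ If these are compatible, i.e. $\sum_{\omega\in\Omega_{W_n}}\mu^{(n)}_{\mathbf{h},\rho}(\sigma_{n-1}\vee\omega)=\mu^{(n-1)}_{\mathbf{h},\rho}(\sigma_{n-1})$ for all $n\geq 2$ and $\sigma_{n-1}\in\Omega_{V_{n-1}}$ (where $\sigma_{n-1}\vee\omega$ is the concatenated configuration on $V_n$), then there is a unique $p$-adic probability measure $\mu_{\mathbf{h},\rho}$ on the algebra of cylinder subsets of $\Omega$ with $\mu_{\mathbf{h},\rho}(\{\sigma:\sigma|_{V_n}=\sigma_n\})=\mu^{(n)}_{\mathbf{h},\rho}(\sigma_n)$ for all $n\ge1$, $\sigma_n\in\Omega_{V_n}$. Such $\mu_{\mathbf{h},\rho}$ is called a generalized $p$-adic quasi Gibbs measure. It is called a $p$-adic Gibbs measure if $\rho\in\mathcal{E}_p$ and all $h_{i,x}\in\mathcal{E}_p$. It is called translation-invariant if $\mathbf{h}_x$ does not depend on $x\in V\setminus\{x^0\}$. Invariant line. Fix $i_0\in\{1,\dots,q-1\}$. The translation-invariant function with $h_{i_0,x}=h$ and $h_{i,x}=1$ for $i\ne i_0$ (all $x\in V\setminus\{x^0\}$) gives compatible measures iff $h\in\mathbb{Q}_p$ solves the fixed point equation $h=\big(\frac{\rho h+q-1}{h+\rho+q-2}\big)^3$; the resulting measure is said to correspond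 to the solution $h$. The fixed point equation is equivalent to $(x-1)(x^3-Ax^2-Bx+C)=0$ with $$A=\rho^3-3\rho-3q+5,\quad B=\rho(\rho-3)^2+9q+3\rho q(\rho-2)-3q^2-7,\quad C=(q-1)^3.$$ Phase transition. A phase transition occurs if there are at least two distinct generalized $p$-adic quasi Gibbs measures (for the given $\rho$) such that at least one of them is unbounded.
   Formalization: ρ≠1 is assumed: at ρ=1 the only measure is uniform and bounded, so the claim fails. That (a)–(e) yield a root x̃ is not asserted, being false (p=7, q=3, ρ=1+7³ meets (c) with no root); the claim on μ̃ is proved for every root, and the phase transition with no root assumed. *)

theory Defs
  imports
    "HOL-Analysis.Analysis"
    "HOL-Number_Theory.Number_Theory"
    "Berlekamp_Zassenhaus.Finite_Field"
begin

section \<open>The field of $p$-adic numbers\<close>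

subsection \<open>The $p$-adic absolute value on the rationals\<close>

definition rat_padic_norm :: "nat \<Rightarrow> rat \<Rightarrow> real" where
  "rat_padic_norm p r =
     (if r = 0 then 0
      else real p powi (int (multiplicity (int p) (snd (quotient_of r)))
                        - int (multiplicity (int p) (fst (quotient_of r)))))"

lemma rat_padic_norm_0 [simp]: "rat_padic_norm p 0 = 0"
  by (simp add: rat_padic_norm_def)

lemma rat_padic_norm_Fract:
  assumes p: "prime p" and "a \<noteq> 0" "b \<noteq> 0"
  shows "rat_padic_norm p (Rat.Fract a b) =
           real p powi (int (multiplicity (int p) b) - int (multiplicity (int p) a))"
proof -
  obtain c d where cd: "quotient_of (Rat.Fract a b) = (c, d)"
    by (cases "quotient_of (Rat.Fract a b)")
  have d: "d > 0" using quotient_of_denom_pos[OF cd] .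
  have eq: "Rat.Fract a b = Rat.Fract c d"
    using quotient_of_div[OF cd] by (simp add: Fract_of_int_quotient)
  have cross: "a * d = c * b" using eq assms d by (simp add: eq_rat)
  with assms d have c: "c \<noteq> 0" by auto
  have pe: "prime_elem (int p)" using p by auto
  have "multiplicity (int p) a + multiplicity (int p) d
          = multiplicity (int p) c + multiplicity (int p) b"
    using arg_cong[OF cross, of "multiplicity (int p)"] pe assms c d
    by (simp add: prime_elem_multiplicity_mult_distrib)
  hence "int (multiplicity (int p) d) - int (multiplicity (int p) c)
          = int (multiplicity (int p) b) - int (multiplicity (int p) a)" by linarith
  moreover have "Rat.Fract a b \<noteq> 0" using assms by (simp add: Zero_rat_def eq_rat)
  ultimately show ?thesis by (simp add: rat_padic_norm_def cd)
qed

lemma rat_padic_norm_nonneg [simp]: "rat_padic_norm p r \<ge> 0"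
  by (simp add: rat_padic_norm_def)

lemma rat_padic_norm_eq_0_iff: "prime p \<Longrightarrow> rat_padic_norm p r = 0 \<longleftrightarrow> r = 0"
  by (auto simp: rat_padic_norm_def prime_gt_0_nat)

lemma rat_padic_norm_1 [simp]: "prime p \<Longrightarrow> rat_padic_norm p 1 = 1"
  by (simp add: rat_padic_norm_def)

lemma rat_padic_norm_mult:
  assumes p: "prime p"
  shows "rat_padic_norm p (r * s) = rat_padic_norm p r * rat_padic_norm p s"
proof (cases "r = 0 \<or> s = 0")
  case False
  obtain a b where r: "r = Rat.Fract a b" "b > 0" by (cases r) auto
  obtain c d where s: "s = Rat.Fract c d" "d > 0" by (cases s) auto
  have nz: "a \<noteq> 0" "c \<noteq> 0" using False r s by (auto simp: rat_number_collapse)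
  have pe: "prime_elem (int p)" and p0: "real p \<noteq> 0" using p by (auto simp: prime_gt_0_nat)
  have "rat_padic_norm p (r * s) = rat_padic_norm p (Rat.Fract (a * c) (b * d))"
    by (simp add: r s)
  also have "\<dots> = real p powi ((int (multiplicity (int p) b) - int (multiplicity (int p) a))
                              + (int (multiplicity (int p) d) - int (multiplicity (int p) c)))"
    using p nz r(2) s(2) pe
    by (simp add: rat_padic_norm_Fract prime_elem_multiplicity_mult_distrib algebra_simps)
  also have "\<dots> = rat_padic_norm p r * rat_padic_norm p s"
    using p nz r s p0 by (simp add: rat_padic_norm_Fract power_int_add)
  finally show ?thesis .
qed auto

lemma rat_padic_norm_minus:
  assumes "prime p" shows "rat_padic_norm p (- r) = rat_padic_norm p r"
proof -
  have "rat_padic_norm p (- 1) = 1"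
    by (simp add: rat_padic_norm_def rat_uminus_code multiplicity_unit_right)
  thus ?thesis using rat_padic_norm_mult[OF assms, of "- 1" r] by simp
qed

lemma rat_padic_norm_of_int_le_1:
  assumes "prime p" shows "rat_padic_norm p (of_int a) \<le> 1"
proof (cases "a = 0")
  case False
  have "rat_padic_norm p (of_int a) = real p powi (- int (multiplicity (int p) a))"
    using assms False by (simp add: rat_padic_norm_def)
  also have "\<dots> = 1 / real p ^ multiplicity (int p) a"
    by (simp add: power_int_minus field_simps)
  also have "\<dots> \<le> 1"
    using prime_ge_1_nat[OF assms] by (simp add: divide_le_eq one_le_power)
  finally show ?thesis .
qed simp

lemma rat_padic_norm_ultra:
  assumes p: "prime p"
  shows "rat_padic_norm p (r + s) \<le> max (rat_padic_norm p r) (rat_padic_norm p s)"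
proof -
  let ?N = "rat_padic_norm p"
  \<comment> \<open>It suffices to bound \<open>|1 + x|\<close> for \<open>|x| \<le> 1\<close>.\<close>
  have key: "?N (1 + x) \<le> 1" if x: "?N x \<le> 1" for x
  proof (cases "x = 0")
    case False
    obtain c d where q: "quotient_of x = (c, d)" by (cases "quotient_of x")
    have d: "d > 0" using quotient_of_denom_pos[OF q] .
    have xd: "x = of_int c / of_int d" using quotient_of_div[OF q] .
    have c: "c \<noteq> 0" using False xd by auto
    have cop: "coprime c d" using quotient_of_coprime[OF q] .
    have "\<not> int p dvd d"
    proof
      assume pd: "int p dvd d"
      hence "\<not> int p dvd c" using cop p
        by (metis coprime_common_divisor not_prime_unit prime_nat_int_transfer)
      hence "multiplicity (int p) c = 0" by (rule not_dvd_imp_multiplicity_0)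
      moreover have "multiplicity (int p) d > 0"
        using pd d p by (metis less_int_code(1) multiplicity_gt_zero_iff not_prime_unit prime_nat_int_transfer)
      ultimately have "?N x = real p powi int (multiplicity (int p) d)"
        using False q by (simp add: rat_padic_norm_def)
      also have "\<dots> > 1" using \<open>multiplicity (int p) d > 0\<close> prime_gt_1_nat[OF p]
        by (simp add: one_less_power)
      finally show False using x by simp
    qed
    hence "?N (of_int d) = 1"
      using d p by (simp add: rat_padic_norm_def not_dvd_imp_multiplicity_0)
    moreover have "(1 + x) * of_int d = of_int (d + c)"
      using d by (simp add: xd field_simps)
    ultimately have "?N (1 + x) = ?N (of_int (d + c))"
      using rat_padic_norm_mult[OF p, of "1 + x" "of_int d"] by simp
    thus ?thesis using rat_padic_norm_of_int_le_1[OF p, of "d + c"] by simp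
  qed (use p in simp)
  have step: "?N (r + s) \<le> ?N r" if le: "?N s \<le> ?N r" for r s
  proof (cases "r = 0")
    case True
    hence "s = 0" using le p rat_padic_norm_eq_0_iff[OF p, of s] by (simp add: order_antisym)
    thus ?thesis by simp
  next
    case False
    have r0: "?N r > 0" using False rat_padic_norm_eq_0_iff[OF p, of r] by (simp add: less_le)
    have "?N (s / r) * ?N r = ?N s"
      using False by (simp flip: rat_padic_norm_mult[OF p])
    hence "?N (s / r) * ?N r \<le> 1 * ?N r" using le by simp
    hence "?N (s / r) \<le> 1" using r0 by (rule mult_right_le_imp_le)
    hence "?N (1 + s / r) * ?N r \<le> 1 * ?N r" by (intro mult_right_mono key) auto
    moreover have "?N (1 + s / r) * ?N r = ?N (r + s)"
    proof -
      have "(1 + s / r) * r = r + s" using False by (simp add: field_simps)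
      thus ?thesis using rat_padic_norm_mult[OF p, of "1 + s / r" r] by simp
    qed
    ultimately show ?thesis by simp
  qed
  show ?thesis using step[of s r] step[of r s] by (cases "?N s \<le> ?N r") (auto simp: add.commute)
qed

lemma rat_padic_norm_triangle:
  "prime p \<Longrightarrow> rat_padic_norm p (r + s) \<le> rat_padic_norm p r + rat_padic_norm p s"
  by (rule order_trans[OF rat_padic_norm_ultra]) auto

lemma rat_padic_norm_diff_commute:
  "prime p \<Longrightarrow> rat_padic_norm p (r - s) = rat_padic_norm p (s - r)"
  by (metis minus_diff_eq rat_padic_norm_minus)

lemma rat_padic_norm_triangle_diff:
  assumes "prime p"
  shows "\<bar>rat_padic_norm p r - rat_padic_norm p s\<bar> \<le> rat_padic_norm p (r - s)"
  using rat_padic_norm_triangle[OF assms, of "r - s" s] rat_padic_norm_triangle[OF assms, of "s - r" r]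
  by (simp add: rat_padic_norm_diff_commute[OF assms, of s r])

subsection \<open>Completion\<close>

definition padic_Cauchy :: "nat \<Rightarrow> (nat \<Rightarrow> rat) \<Rightarrow> bool" where
  "padic_Cauchy p X \<longleftrightarrow>
     (\<forall>e>0. \<exists>N. \<forall>m\<ge>N. \<forall>n\<ge>N. rat_padic_norm p (X m - X n) < e)"

definition padic_null :: "nat \<Rightarrow> (nat \<Rightarrow> rat) \<Rightarrow> bool" where
  "padic_null p X \<longleftrightarrow> (\<lambda>n. rat_padic_norm p (X n)) \<longlonglongrightarrow> 0"

context
  fixes p :: nat
  assumes p: "prime p"
begin

private abbreviation (input) N where "N \<equiv> rat_padic_norm p"

lemma padic_null_const_iff: "padic_null p (\<lambda>_. r) \<longleftrightarrow> r = 0"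
  by (simp add: padic_null_def LIMSEQ_const_iff rat_padic_norm_eq_0_iff[OF p])

lemma padic_null_add:
  assumes "padic_null p X" "padic_null p Y" shows "padic_null p (\<lambda>n. X n + Y n)"
  unfolding padic_null_def
proof (rule tendsto_sandwich[OF always_eventually always_eventually tendsto_const])
  show "(\<lambda>n. N (X n) + N (Y n)) \<longlonglongrightarrow> 0"
    using tendsto_add[OF assms[unfolded padic_null_def]] by simp
qed (auto simp: rat_padic_norm_triangle[OF p])

lemma padic_null_minus: "padic_null p (\<lambda>n. - X n) \<longleftrightarrow> padic_null p X"
  by (simp add: padic_null_def rat_padic_norm_minus[OF p])

lemma padic_null_diff_commute: "padic_null p (\<lambda>n. X n - Y n) \<longleftrightarrow> padic_null p (\<lambda>n. Y n - X n)"
  using padic_null_minus[of "\<lambda>n. X n - Y n"] by simp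

lemma padic_Cauchy_const: "padic_Cauchy p (\<lambda>_. r)"
  by (simp add: padic_Cauchy_def)

lemma padic_Cauchy_bounded:
  assumes "padic_Cauchy p X" obtains B where "B > 0" "\<And>n. N (X n) \<le> B"
proof -
  from assms obtain M where M: "\<And>m n. m \<ge> M \<Longrightarrow> n \<ge> M \<Longrightarrow> N (X m - X n) < 1"
    unfolding padic_Cauchy_def by (meson zero_less_one)
  define B where "B = 1 + N (X M) + (\<Sum>k<M. N (X k))"
  have "N (X n) \<le> B" for n
  proof (cases "n < M")
    case True
    hence "N (X n) \<le> (\<Sum>k<M. N (X k))" by (intro member_le_sum) auto
    moreover have "0 \<le> N (X M)" by simp
    ultimately show ?thesis unfolding B_def by linarith
  next
    case False
    have "N (X n) \<le> N (X n - X M) + N (X M)"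
      using rat_padic_norm_triangle[OF p, of "X n - X M" "X M"] by simp
    also have "\<dots> \<le> 1 + N (X M)" using M[of n M] False by simp
    also have "\<dots> \<le> B" by (simp add: B_def sum_nonneg)
    finally show ?thesis .
  qed
  moreover have "B > 0" by (simp add: B_def add_pos_nonneg sum_nonneg)
  ultimately show thesis using that by blast
qed

lemma padic_Cauchy_add:
  assumes "padic_Cauchy p X" "padic_Cauchy p Y" shows "padic_Cauchy p (\<lambda>n. X n + Y n)"
  unfolding padic_Cauchy_def
proof (intro allI impI)
  fix e :: real assume e: "e > 0"
  obtain M1 where M1: "\<And>m n. m \<ge> M1 \<Longrightarrow> n \<ge> M1 \<Longrightarrow> N (X m - X n) < e"
    using assms(1) e unfolding padic_Cauchy_def by meson
  obtain M2 where M2: "\<And>m n. m \<ge> M2 \<Longrightarrow> n \<ge> M2 \<Longrightarrow> N (Y m - Y n) < e"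
    using assms(2) e unfolding padic_Cauchy_def by meson
  have "N ((X m + Y m) - (X n + Y n)) < e" if "m \<ge> max M1 M2" "n \<ge> max M1 M2" for m n
  proof -
    have "N ((X m - X n) + (Y m - Y n)) \<le> max (N (X m - X n)) (N (Y m - Y n))"
      by (rule rat_padic_norm_ultra[OF p])
    also have "\<dots> < e" using M1[of m n] M2[of m n] that by simp
    finally show ?thesis by (simp add: algebra_simps)
  qed
  thus "\<exists>M. \<forall>m\<ge>M. \<forall>n\<ge>M. N ((X m + Y m) - (X n + Y n)) < e" by blast
qed

lemma padic_Cauchy_minus: "padic_Cauchy p X \<Longrightarrow> padic_Cauchy p (\<lambda>n. - X n)"
  by (simp add: padic_Cauchy_def rat_padic_norm_diff_commute[OF p])

lemma padic_Cauchy_mult: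
  assumes "padic_Cauchy p X" "padic_Cauchy p Y" shows "padic_Cauchy p (\<lambda>n. X n * Y n)"
  unfolding padic_Cauchy_def
proof (intro allI impI)
  fix e :: real assume e: "e > 0"
  obtain A where A: "A > 0" "\<And>n. N (X n) \<le> A" using padic_Cauchy_bounded[OF assms(1)] by blast
  obtain B where B: "B > 0" "\<And>n. N (Y n) \<le> B" using padic_Cauchy_bounded[OF assms(2)] by blast
  obtain M1 where M1: "\<And>m n. m \<ge> M1 \<Longrightarrow> n \<ge> M1 \<Longrightarrow> N (X m - X n) < e / B"
    using assms(1) e B(1) unfolding padic_Cauchy_def by (meson divide_pos_pos)
  obtain M2 where M2: "\<And>m n. m \<ge> M2 \<Longrightarrow> n \<ge> M2 \<Longrightarrow> N (Y m - Y n) < e / A"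
    using assms(2) e A(1) unfolding padic_Cauchy_def by (meson divide_pos_pos)
  have "N (X m * Y m - X n * Y n) < e" if "m \<ge> max M1 M2" "n \<ge> max M1 M2" for m n
  proof -
    have 1: "N (X m * (Y m - Y n)) < e"
    proof -
      have "N (X m * (Y m - Y n)) \<le> A * N (Y m - Y n)"
        using A(2)[of m] by (simp add: rat_padic_norm_mult[OF p] mult_right_mono)
      also have "\<dots> < A * (e / A)" using M2[of m n] that A(1) by (intro mult_strict_left_mono) auto
      finally show ?thesis using A(1) by simp
    qed
    have 2: "N (Y n * (X m - X n)) < e"
    proof -
      have "N (Y n * (X m - X n)) \<le> B * N (X m - X n)"
        using B(2)[of n] by (simp add: rat_padic_norm_mult[OF p] mult_right_mono)
      also have "\<dots> < B * (e / B)" using M1[of m n] that B(1) by (intro mult_strict_left_mono) auto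
      finally show ?thesis using B(1) by simp
    qed
    have "N (X m * (Y m - Y n) + Y n * (X m - X n))
            \<le> max (N (X m * (Y m - Y n))) (N (Y n * (X m - X n)))"
      by (rule rat_padic_norm_ultra[OF p])
    also have "\<dots> < e" using 1 2 by simp
    finally show ?thesis by (simp add: algebra_simps)
  qed
  thus "\<exists>M. \<forall>m\<ge>M. \<forall>n\<ge>M. N (X m * Y m - X n * Y n) < e" by blast
qed

lemma padic_null_mult:
  assumes X: "padic_null p X" and Y: "padic_Cauchy p Y" shows "padic_null p (\<lambda>n. Y n * X n)"
proof -
  obtain B where B: "B > 0" "\<And>n. N (Y n) \<le> B" using padic_Cauchy_bounded[OF Y] by blast
  have "(\<lambda>n. N (Y n * X n)) \<longlonglongrightarrow> 0"
  proof (rule tendsto_sandwich[OF always_eventually always_eventually tendsto_const])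
    show "(\<lambda>n. B * N (X n)) \<longlonglongrightarrow> 0"
      using tendsto_mult_right_zero[OF X[unfolded padic_null_def]] .
  qed (auto simp: rat_padic_norm_mult[OF p] B(2) mult_right_mono)
  thus ?thesis by (simp add: padic_null_def)
qed

lemma padic_Cauchy_norm_convergent:
  assumes "padic_Cauchy p X" shows "convergent (\<lambda>n. N (X n))"
proof -
  have "Cauchy (\<lambda>n. N (X n))"
  proof (rule metric_CauchyI)
    fix e :: real assume "e > 0"
    then obtain M where M: "\<And>m n. m \<ge> M \<Longrightarrow> n \<ge> M \<Longrightarrow> N (X m - X n) < e"
      using assms unfolding padic_Cauchy_def by meson
    have "dist (N (X m)) (N (X n)) < e" if "m \<ge> M" "n \<ge> M" for m n
      using M[OF that] rat_padic_norm_triangle_diff[OF p, of "X m" "X n"]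
      by (simp add: dist_real_def)
    thus "\<exists>M. \<forall>m\<ge>M. \<forall>n\<ge>M. dist (N (X m)) (N (X n)) < e" by blast
  qed
  thus ?thesis by (rule Cauchy_convergent)
qed

lemma padic_Cauchy_nonnull_bounded_below:
  assumes X: "padic_Cauchy p X" and nn: "\<not> padic_null p X"
  obtains e M where "e > 0" "\<And>n. n \<ge> M \<Longrightarrow> N (X n) > e"
proof -
  obtain L where L: "(\<lambda>n. N (X n)) \<longlonglongrightarrow> L"
    using padic_Cauchy_norm_convergent[OF X] by (auto simp: convergent_def)
  have "L \<ge> 0" by (rule LIMSEQ_le_const[OF L]) auto
  with nn L have "L > 0" by (auto simp: padic_null_def less_le)
  hence "eventually (\<lambda>n. N (X n) > L / 2) sequentially" by (intro order_tendstoD[OF L]) simp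
  then obtain M where "\<And>n. n \<ge> M \<Longrightarrow> N (X n) > L / 2" by (auto simp: eventually_sequentially)
  thus thesis using that[of "L / 2" M] \<open>L > 0\<close> by simp
qed

lemma padic_Cauchy_inverse:
  assumes X: "padic_Cauchy p X" and nn: "\<not> padic_null p X"
  shows "padic_Cauchy p (\<lambda>n. inverse (X n))"
  unfolding padic_Cauchy_def
proof (intro allI impI)
  fix e :: real assume e: "e > 0"
  obtain d M where d: "d > 0" "\<And>n. n \<ge> M \<Longrightarrow> N (X n) > d"
    using padic_Cauchy_nonnull_bounded_below[OF X nn] by blast
  obtain K where K: "\<And>m n. m \<ge> K \<Longrightarrow> n \<ge> K \<Longrightarrow> N (X m - X n) < e * (d * d)"
    using X e d(1) unfolding padic_Cauchy_def by (meson mult_pos_pos)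
  have "N (inverse (X m) - inverse (X n)) < e" if mn: "m \<ge> max M K" "n \<ge> max M K" for m n
  proof -
    let ?D = "inverse (X m) - inverse (X n)"
    have nz: "X m \<noteq> 0" "X n \<noteq> 0" using d(1) d(2)[of m] d(2)[of n] mn by auto
    hence "?D * (X m * X n) = X n - X m" by (simp add: field_simps)
    hence eq: "N ?D * (N (X m) * N (X n)) = N (X n - X m)"
      by (metis rat_padic_norm_mult[OF p])
    have "N ?D * (d * d) \<le> N ?D * (N (X m) * N (X n))"
      using d(1) d(2)[of m] d(2)[of n] mn by (intro mult_left_mono mult_mono) auto
    also have "\<dots> < e * (d * d)" using eq K[of n m] mn by simp
    finally show ?thesis using d(1) by simp
  qed
  thus "\<exists>M. \<forall>m\<ge>M. \<forall>n\<ge>M. N (inverse (X m) - inverse (X n)) < e" by blast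
qed

end

definition padic_rel :: "nat \<Rightarrow> (nat \<Rightarrow> rat) \<Rightarrow> (nat \<Rightarrow> rat) \<Rightarrow> bool" where
  "padic_rel p X Y \<longleftrightarrow>
     padic_Cauchy p X \<and> padic_Cauchy p Y \<and> padic_null p (\<lambda>n. X n - Y n)"

lemma equiv_padic_rel:
  assumes "prime p"
  shows "equiv {X. padic_Cauchy p X} {(X, Y). padic_rel p X Y}"
proof (rule equivI)
  show "{(X, Y). padic_rel p X Y} \<subseteq> {X. padic_Cauchy p X} \<times> {X. padic_Cauchy p X}"
    by (auto simp: padic_rel_def)
  show "refl_on {X. padic_Cauchy p X} {(X, Y). padic_rel p X Y}"
    using assms by (auto simp: refl_on_def padic_rel_def padic_null_const_iff)
  show "sym {(X, Y). padic_rel p X Y}"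
    using padic_null_diff_commute[OF assms] by (auto simp: sym_def padic_rel_def)
  show "trans {(X, Y). padic_rel p X Y}"
  proof (rule transI, clarify)
    fix X Y Z assume "padic_rel p X Y" "padic_rel p Y Z"
    thus "padic_rel p X Z"
      using padic_null_add[OF assms, of "\<lambda>n. X n - Y n" "\<lambda>n. Y n - Z n"]
      by (auto simp: padic_rel_def)
  qed
qed

text \<open>
  The prime is the cardinality of the index type \<open>'p\<close>, in the same way as for
  \<open>'p mod_ring\<close>; thus \<open>'p padic\<close> is the field of $p$-adic numbers for \<open>p = CARD('p)\<close>.
\<close>

typedef (overloaded) 'p padic =
  "{X. padic_Cauchy CARD('p::prime_card) X} // {(X, Y). padic_rel CARD('p) X Y}"
proof -
  have "(\<lambda>_. 0) \<in> {X. padic_Cauchy CARD('p) X}"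
    by (simp add: padic_Cauchy_const[OF prime_card])
  thus ?thesis by (blast intro: quotientI)
qed

text \<open>The class of a Cauchy sequence, that is, its limit, and a chosen representative.\<close>

definition padic_lim :: "(nat \<Rightarrow> rat) \<Rightarrow> 'p::prime_card padic" where
  "padic_lim X = Abs_padic ({(X, Y). padic_rel CARD('p) X Y} `` {X})"

definition padic_seq :: "'p::prime_card padic \<Rightarrow> nat \<Rightarrow> rat" where
  "padic_seq x = (SOME X. X \<in> Rep_padic x)"

lemma padic_lim_eq_iff:
  assumes "padic_Cauchy CARD('p) X" "padic_Cauchy CARD('p) Y"
  shows "(padic_lim X :: 'p::prime_card padic) = padic_lim Y
           \<longleftrightarrow> padic_null CARD('p) (\<lambda>n. X n - Y n)"
proof -
  let ?A = "{X. padic_Cauchy CARD('p) X}" and ?R = "{(X, Y). padic_rel CARD('p) X Y}"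
  have XY: "X \<in> ?A" "Y \<in> ?A" using assms by auto
  have "(padic_lim X :: 'p padic) = padic_lim Y \<longleftrightarrow> ?R `` {X} = ?R `` {Y}"
    unfolding padic_lim_def by (rule Abs_padic_inject) (intro quotientI XY)+
  also have "\<dots> \<longleftrightarrow> (X, Y) \<in> ?R"
    by (rule eq_equiv_class_iff[OF equiv_padic_rel XY]) (rule prime_card)
  finally have "(padic_lim X :: 'p padic) = padic_lim Y \<longleftrightarrow> padic_rel CARD('p) X Y" by simp
  thus ?thesis using assms by (simp add: padic_rel_def)
qed

lemma padic_seq:
  fixes x :: "'p::prime_card padic"
  shows "padic_Cauchy CARD('p) (padic_seq x)" "padic_lim (padic_seq x) = x"
proof -
  note E = equiv_padic_rel[OF prime_card[where 'a='p]]
  obtain X where X: "padic_Cauchy CARD('p) X" "Rep_padic x = {(X, Y). padic_rel CARD('p) X Y} `` {X}"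
    using Rep_padic[of x] by (auto elim!: quotientE)
  hence "X \<in> Rep_padic x"
    by (auto simp: padic_rel_def padic_null_const_iff[OF prime_card])
  hence "padic_seq x \<in> Rep_padic x" 
    unfolding padic_seq_def by (rule someI[where P = "\<lambda>X. X \<in> Rep_padic x"])
  hence rel: "padic_rel CARD('p) X (padic_seq x)" using X by simp
  thus C: "padic_Cauchy CARD('p) (padic_seq x)" by (simp add: padic_rel_def)
  have "padic_lim (padic_seq x) = (padic_lim X :: 'p padic)"
    using rel by (subst padic_lim_eq_iff)
      (auto simp: padic_rel_def padic_null_diff_commute[OF prime_card, of X])
  also have "\<dots> = x" 
    unfolding padic_lim_def X(2)[symmetric] by (rule Rep_padic_inverse)
  finally show "padic_lim (padic_seq x) = x" .
qed

lemma padic_cases: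
  fixes x :: "'p::prime_card padic"
  obtains X where "padic_Cauchy CARD('p) X" "x = padic_lim X"
  using padic_seq[of x] by metis

lemma padic_seq_lim:
  assumes "padic_Cauchy CARD('p) X"
  shows "padic_rel CARD('p) (padic_seq (padic_lim X :: 'p::prime_card padic)) X"
  using assms padic_seq[of "padic_lim X :: 'p padic"] 
    padic_lim_eq_iff[where 'p='p, of "padic_seq (padic_lim X :: 'p padic)" X]
  by (simp add: padic_rel_def)

instantiation padic :: (prime_card) field
begin

definition zero_padic :: "'a padic" where "0 = padic_lim (\<lambda>_. 0)"

definition one_padic :: "'a padic" where "1 = padic_lim (\<lambda>_. 1)"

definition plus_padic :: "'a padic \<Rightarrow> 'a padic \<Rightarrow> 'a padic" where
  "x + y = padic_lim (\<lambda>n. padic_seq x n + padic_seq y n)"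

definition uminus_padic :: "'a padic \<Rightarrow> 'a padic" where
  "- x = padic_lim (\<lambda>n. - padic_seq x n)"

definition minus_padic :: "'a padic \<Rightarrow> 'a padic \<Rightarrow> 'a padic" where
  "x - y = x + (- y)" for x y :: "'a padic"

definition times_padic :: "'a padic \<Rightarrow> 'a padic \<Rightarrow> 'a padic" where
  "x * y = padic_lim (\<lambda>n. padic_seq x n * padic_seq y n)"

definition inverse_padic :: "'a padic \<Rightarrow> 'a padic" where
  "inverse x = (if x = 0 then 0 else padic_lim (\<lambda>n. inverse (padic_seq x n)))"

definition divide_padic :: "'a padic \<Rightarrow> 'a padic \<Rightarrow> 'a padic" where
  "x div y = x * inverse y" for x y :: "'a padic"

lemma padic_lim_eqI:
  assumes "padic_rel CARD('a) X Y" shows "padic_lim X = (padic_lim Y :: 'a padic)"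
  using assms by (subst padic_lim_eq_iff) (auto simp: padic_rel_def)

lemma padic_lim_add:
  assumes "padic_Cauchy CARD('a) X" "padic_Cauchy CARD('a) Y"
  shows "padic_lim X + padic_lim Y = (padic_lim (\<lambda>n. X n + Y n) :: 'a padic)"
  unfolding plus_padic_def
proof (rule padic_lim_eqI)
  let ?X = "padic_seq (padic_lim X :: 'a padic)" and ?Y = "padic_seq (padic_lim Y :: 'a padic)"
  have r: "padic_rel CARD('a) ?X X" "padic_rel CARD('a) ?Y Y" using assms by (auto intro: padic_seq_lim)
  have "padic_null CARD('a) (\<lambda>n. (?X n - X n) + (?Y n - Y n))"
    using r by (intro padic_null_add prime_card) (auto simp: padic_rel_def)
  thus "padic_rel CARD('a) (\<lambda>n. ?X n + ?Y n) (\<lambda>n. X n + Y n)"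
    using r by (simp add: padic_rel_def padic_Cauchy_add[OF prime_card] algebra_simps)
qed

lemma padic_lim_mult:
  assumes "padic_Cauchy CARD('a) X" "padic_Cauchy CARD('a) Y"
  shows "padic_lim X * padic_lim Y = (padic_lim (\<lambda>n. X n * Y n) :: 'a padic)"
  unfolding times_padic_def
proof (rule padic_lim_eqI)
  let ?X = "padic_seq (padic_lim X :: 'a padic)" and ?Y = "padic_seq (padic_lim Y :: 'a padic)"
  have r: "padic_rel CARD('a) ?X X" "padic_rel CARD('a) ?Y Y" using assms by (auto intro: padic_seq_lim)
  have "padic_null CARD('a) (\<lambda>n. ?X n * (?Y n - Y n) + Y n * (?X n - X n))"
    using r by (intro padic_null_add padic_null_mult prime_card) (auto simp: padic_rel_def)
  thus "padic_rel CARD('a) (\<lambda>n. ?X n * ?Y n) (\<lambda>n. X n * Y n)"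
    using r by (simp add: padic_rel_def padic_Cauchy_mult[OF prime_card] algebra_simps)
qed

lemma padic_lim_minus:
  assumes "padic_Cauchy CARD('a) X"
  shows "- padic_lim X = (padic_lim (\<lambda>n. - X n) :: 'a padic)"
  unfolding uminus_padic_def
proof (rule padic_lim_eqI)
  let ?X = "padic_seq (padic_lim X :: 'a padic)"
  have r: "padic_rel CARD('a) ?X X" using assms by (auto intro: padic_seq_lim)
  moreover have "padic_null CARD('a) (\<lambda>n. - (?X n - X n))"
    using r by (subst padic_null_minus) (auto simp: padic_rel_def prime_card)
  ultimately show "padic_rel CARD('a) (\<lambda>n. - ?X n) (\<lambda>n. - X n)"
    by (simp add: padic_rel_def padic_Cauchy_minus[OF prime_card])
qed

instance
proof
  fix a b c :: "'a padic"
  let ?p = "CARD('a)"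
  obtain A where A: "padic_Cauchy ?p A" "a = padic_lim A" by (rule padic_cases)
  obtain B where B: "padic_Cauchy ?p B" "b = padic_lim B" by (rule padic_cases)
  obtain C where C: "padic_Cauchy ?p C" "c = padic_lim C" by (rule padic_cases)
  note simps = A(2) B(2) C(2) zero_padic_def one_padic_def padic_lim_add padic_lim_mult padic_lim_minus A(1) B(1) C(1)
    padic_Cauchy_add[OF prime_card] padic_Cauchy_mult[OF prime_card] padic_Cauchy_minus[OF prime_card]
    padic_Cauchy_const[OF prime_card]
  show "a + b + c = a + (b + c)" by (simp add: simps add.assoc)
  show "a + b = b + a" by (simp add: simps add.commute)
  show "0 + a = a" by (simp add: simps)
  show "- a + a = 0" by (simp add: simps)
  show "a - b = a + - b" by (rule minus_padic_def)
  show "a * b * c = a * (b * c)" by (simp add: simps mult.assoc)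
  show "a * b = b * a" by (simp add: simps mult.commute)
  show "1 * a = a" by (simp add: simps)
  show "(a + b) * c = a * c + b * c" by (simp add: simps algebra_simps)
  show "(0 :: 'a padic) \<noteq> 1"
    by (simp add: simps padic_lim_eq_iff padic_null_const_iff[OF prime_card])
  show "inverse (0 :: 'a padic) = 0" by (simp add: inverse_padic_def)
  show "a div b = a * inverse b" by (rule divide_padic_def)
  show "inverse a * a = 1" if a0: "a \<noteq> 0"
  proof -
    let ?X = "padic_seq a"
    have X: "padic_Cauchy ?p ?X" and aX: "padic_lim ?X = a" by (fact padic_seq)+
    have nn: "\<not> padic_null ?p ?X"
    proof
      assume "padic_null ?p ?X"
      hence "padic_lim ?X = (padic_lim (\<lambda>_. 0) :: 'a padic)"
        using X by (subst padic_lim_eq_iff) (auto simp: padic_Cauchy_const[OF prime_card])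
      thus False using a0 aX by (simp add: zero_padic_def)
    qed
    note iX = padic_Cauchy_inverse[OF prime_card X nn]
    obtain d M where d: "d > 0" "\<And>n. n \<ge> M \<Longrightarrow> rat_padic_norm ?p (?X n) > d"
      using padic_Cauchy_nonnull_bounded_below[OF prime_card X nn] by blast
    have "inverse (?X n) * ?X n = 1" if "n \<ge> M" for n
    proof -
      have "?X n \<noteq> 0" using d(1) d(2)[OF that] by auto
      thus ?thesis by simp
    qed
    hence "eventually (\<lambda>n. rat_padic_norm ?p (inverse (?X n) * ?X n - 1) = 0) sequentially"
      by (auto simp: eventually_sequentially intro!: exI[of _ M])
    hence null: "padic_null ?p (\<lambda>n. inverse (?X n) * ?X n - 1)"
      unfolding padic_null_def by (rule tendsto_eventually)
    have "inverse a * a = padic_lim (\<lambda>n. inverse (?X n)) * padic_lim ?X"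
      using a0 by (simp add: inverse_padic_def aX)
    also have "\<dots> = padic_lim (\<lambda>n. inverse (?X n) * ?X n)" using iX X by (rule padic_lim_mult)
    also have "\<dots> = 1"
      unfolding one_padic_def using null iX X
      by (subst padic_lim_eq_iff)
         (auto intro: padic_Cauchy_mult[OF prime_card] padic_Cauchy_const[OF prime_card])
    finally show ?thesis .
  qed
qed

end


definition padic_norm :: "'p::prime_card padic \<Rightarrow> real" where
  "padic_norm x = lim (\<lambda>n. rat_padic_norm CARD('p) (padic_seq x n))"

lemma padic_norm_lim:
  assumes "padic_Cauchy CARD('p) X"
  shows "(\<lambda>n. rat_padic_norm CARD('p) (X n)) \<longlonglongrightarrow> padic_norm (padic_lim X :: 'p::prime_card padic)"
proof -
  let ?N = "rat_padic_norm CARD('p)" and ?Y = "padic_seq (padic_lim X :: 'p padic)"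
  have rel: "padic_rel CARD('p) ?Y X" using assms by (rule padic_seq_lim)
  have L: "(\<lambda>n. ?N (?Y n)) \<longlonglongrightarrow> padic_norm (padic_lim X :: 'p padic)"
    using padic_Cauchy_norm_convergent[OF prime_card[where 'a='p] padic_seq(1)[of "padic_lim X :: 'p padic"]]
    unfolding padic_norm_def by (simp only: convergent_LIMSEQ_iff)
  have "(\<lambda>n. ?N (?Y n - X n)) \<longlonglongrightarrow> 0" using rel by (simp add: padic_rel_def padic_null_def)
  moreover have "norm (?N (X n) - ?N (?Y n)) \<le> ?N (?Y n - X n)" for n
    using rat_padic_norm_triangle_diff[OF prime_card[where 'a='p], of "?Y n" "X n"]
    by (simp add: abs_minus_commute)
  ultimately have "(\<lambda>n. ?N (X n) - ?N (?Y n)) \<longlonglongrightarrow> 0"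
    by (intro Lim_null_comparison[of "\<lambda>n. ?N (X n) - ?N (?Y n)"] always_eventually) auto
  from tendsto_add[OF this L] show ?thesis by simp
qed

lemma of_nat_padic: "(of_nat k :: 'p::prime_card padic) = padic_lim (\<lambda>_. of_nat k)"
  by (induction k)
     (simp_all add: zero_padic_def one_padic_def padic_lim_add padic_Cauchy_const[OF prime_card])

instance padic :: (prime_card) field_char_0
proof
  show "inj (of_nat :: nat \<Rightarrow> 'a padic)"
    by (rule injI)
       (simp add: of_nat_padic padic_lim_eq_iff padic_Cauchy_const[OF prime_card]
          padic_null_const_iff[OF prime_card])
qed

lemma of_int_padic: "(of_int k :: 'p::prime_card padic) = padic_lim (\<lambda>_. of_int k)"
  by (cases k rule: int_cases2)
     (simp_all add: of_nat_padic padic_lim_minus padic_Cauchy_const[OF prime_card])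

lemma of_rat_padic: "(of_rat r :: 'p::prime_card padic) = padic_lim (\<lambda>_. r)"
proof -
  obtain a b where r: "r = Rat.Fract a b" "b > 0" by (cases r) auto
  have "padic_lim (\<lambda>_. r) * of_int b = (of_int a :: 'p padic)"
    using r by (simp add: of_int_padic padic_lim_mult padic_Cauchy_const[OF prime_card] Fract_of_int_quotient)
  thus ?thesis using r by (simp add: of_rat_rat field_simps)
qed

lemma padic_norm_of_rat: "padic_norm (of_rat r :: 'p::prime_card padic) = rat_padic_norm CARD('p) r"
  using padic_norm_lim[OF padic_Cauchy_const[OF prime_card[where 'a='p], of r]]
  by (simp add: of_rat_padic LIMSEQ_const_iff)

definition padic_E :: "'p::prime_card padic set" where
  "padic_E = {x. padic_norm x = 1
                 \<and> padic_norm (x - 1) < real CARD('p) powr (- 1 / (real CARD('p) - 1))}"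

section \<open>The Potts model on the semi-infinite Cayley tree of order three\<close>

text \<open>
  A vertex is the list of choices made on the path from the root, most recent first: the root is
  \<open>[]\<close>, the three direct successors of \<open>x\<close> are \<open>i # x\<close>, and the distance of \<open>x\<close> from the root is
  \<open>length x\<close>.
\<close>

type_synonym vertex = "3 list"

definition tree_level :: "nat \<Rightarrow> vertex set" where
  "tree_level n = {x. length x = n}"

definition tree_ball :: "nat \<Rightarrow> vertex set" where
  "tree_ball n = (\<Union>m\<le>n. tree_level m)"

text \<open>Every edge is listed once, as the pair of a vertex and one of its direct successors.\<close>

definition tree_edges :: "nat \<Rightarrow> (vertex \<times> vertex) set" where
  "tree_edges n = {(x, y). x \<in> tree_ball n \<and> y \<in> tree_ball n \<and> (\<exists>i. y = i # x)}"

definition configs :: "nat \<Rightarrow> vertex set \<Rightarrow> (vertex \<Rightarrow> nat) set" where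
  "configs q A = A \<rightarrow>\<^sub>E {0..<q}"

definition hamiltonian :: "nat \<Rightarrow> (vertex \<Rightarrow> nat) \<Rightarrow> nat" where
  "hamiltonian n \<sigma> = (\<Sum>(x, y)\<in>tree_edges n. of_bool (\<sigma> x = \<sigma> y))"

text \<open>
  A boundary function \<open>h\<close> has \<open>h x i\<close> for $h_{i,x}$. Its values at the root, and at \<open>i \<ge> q\<close>, are
  never used.
\<close>

type_synonym 'p boundary = "vertex \<Rightarrow> nat \<Rightarrow> 'p padic"

definition gibbs_weight ::
  "'p::prime_card padic \<Rightarrow> 'p boundary \<Rightarrow> nat \<Rightarrow> (vertex \<Rightarrow> nat) \<Rightarrow> 'p padic" where
  "gibbs_weight \<rho> h n \<sigma> = \<rho> ^ hamiltonian n \<sigma> * (\<Prod>x\<in>tree_level n. h x (\<sigma> x))"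

definition partition_function ::
  "nat \<Rightarrow> 'p::prime_card padic \<Rightarrow> 'p boundary \<Rightarrow> nat \<Rightarrow> 'p padic" where
  "partition_function q \<rho> h n = (\<Sum>\<sigma>\<in>configs q (tree_ball n). gibbs_weight \<rho> h n \<sigma>)"

definition finite_volume_measure ::
  "nat \<Rightarrow> 'p::prime_card padic \<Rightarrow> 'p boundary \<Rightarrow> nat \<Rightarrow> (vertex \<Rightarrow> nat) \<Rightarrow> 'p padic" where
  "finite_volume_measure q \<rho> h n \<sigma> = gibbs_weight \<rho> h n \<sigma> / partition_function q \<rho> h n"

text \<open>
  The measures on finite volumes are only defined if no partition function vanishes; since
  \<open>x / 0 = 0\<close>, this has to be required explicitly.
\<close>

definition compatible :: "nat \<Rightarrow> 'p::prime_card padic \<Rightarrow> 'p boundary \<Rightarrow> bool" where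
  "compatible q \<rho> h \<longleftrightarrow>
     (\<forall>n\<ge>1. partition_function q \<rho> h n \<noteq> 0) \<and>
     (\<forall>n\<ge>2. \<forall>\<sigma>\<in>configs q (tree_ball (n - 1)).
        (\<Sum>\<omega>\<in>configs q (tree_level n).
           finite_volume_measure q \<rho> h n (merge (tree_ball (n - 1)) (tree_level n) (\<sigma>, \<omega>)))
        = finite_volume_measure q \<rho> h (n - 1) \<sigma>)"

subsection \<open>Measures on the cylinder algebra\<close>

definition cylinder :: "nat \<Rightarrow> nat \<Rightarrow> (vertex \<Rightarrow> nat) set \<Rightarrow> (vertex \<Rightarrow> nat) set" where
  "cylinder q n S = {\<sigma> \<in> configs q UNIV. restrict \<sigma> (tree_ball n) \<in> S}"

definition cylinder_algebra :: "nat \<Rightarrow> (vertex \<Rightarrow> nat) set set" where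
  "cylinder_algebra q = {cylinder q n S | n S. S \<subseteq> configs q (tree_ball n)}"

definition padic_prob_measure ::
  "'a set \<Rightarrow> 'a set set \<Rightarrow> ('a set \<Rightarrow> 'p::prime_card padic) \<Rightarrow> bool" where
  "padic_prob_measure \<Omega> M \<mu> \<longleftrightarrow>
     Sigma_Algebra.algebra \<Omega> M \<and> Measure_Space.additive M \<mu> \<and> \<mu> \<Omega> = 1"

definition padic_bounded :: "'a set set \<Rightarrow> ('a set \<Rightarrow> 'p::prime_card padic) \<Rightarrow> bool" where
  "padic_bounded M \<mu> \<longleftrightarrow> bdd_above ((\<lambda>A. padic_norm (\<mu> A)) ` M)"

definition quasi_gibbs_measure ::
  "nat \<Rightarrow> 'p::prime_card padic \<Rightarrow> 'p boundary \<Rightarrow> ((vertex \<Rightarrow> nat) set \<Rightarrow> 'p padic) \<Rightarrow> bool" where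
  "quasi_gibbs_measure q \<rho> h \<mu> \<longleftrightarrow>
     (\<forall>x. x \<noteq> [] \<longrightarrow> h x 0 = 1) \<and>
     compatible q \<rho> h \<and>
     padic_prob_measure (configs q UNIV) (cylinder_algebra q) \<mu> \<and>
     (\<forall>n\<ge>1. \<forall>\<sigma>\<in>configs q (tree_ball n).
        \<mu> (cylinder q n {\<sigma>}) = finite_volume_measure q \<rho> h n \<sigma>)"

definition gibbs_measure ::
  "nat \<Rightarrow> 'p::prime_card padic \<Rightarrow> 'p boundary \<Rightarrow> ((vertex \<Rightarrow> nat) set \<Rightarrow> 'p padic) \<Rightarrow> bool" where
  "gibbs_measure q \<rho> h \<mu> \<longleftrightarrow>
     quasi_gibbs_measure q \<rho> h \<mu> \<and> \<rho> \<in> padic_E \<and> (\<forall>x. x \<noteq> [] \<longrightarrow> (\<forall>i<q. h x i \<in> padic_E))"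

text \<open>
  Measures are set functions on all sets of configurations, so they are compared on the
  cylinder algebra only.
\<close>

definition phase_transition :: "nat \<Rightarrow> 'p::prime_card padic \<Rightarrow> bool" where
  "phase_transition q \<rho> \<longleftrightarrow>
     (\<exists>h \<mu> h' \<mu>'. quasi_gibbs_measure q \<rho> h \<mu> \<and> quasi_gibbs_measure q \<rho> h' \<mu>' \<and>
        (\<exists>A\<in>cylinder_algebra q. \<mu> A \<noteq> \<mu>' A) \<and>
        (\<not> padic_bounded (cylinder_algebra q) \<mu> \<or> \<not> padic_bounded (cylinder_algebra q) \<mu>'))"

subsection \<open>Translation-invariant measures on the invariant line\<close>

definition line_boundary :: "nat \<Rightarrow> 'p::prime_card padic \<Rightarrow> 'p boundary" where
  "line_boundary i0 h = (\<lambda>x i. if i = i0 then h else 1)"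

text \<open>A solution of the fixed point equation has to make the denominator nonzero.\<close>

definition fixed_point_solution ::
  "nat \<Rightarrow> 'p::prime_card padic \<Rightarrow> 'p padic \<Rightarrow> bool" where
  "fixed_point_solution q \<rho> h \<longleftrightarrow>
     h + \<rho> + of_nat q - 2 \<noteq> 0 \<and>
     h = ((\<rho> * h + of_nat q - 1) / (h + \<rho> + of_nat q - 2)) ^ 3"

definition corresponding_measure ::
  "nat \<Rightarrow> 'p::prime_card padic \<Rightarrow> nat \<Rightarrow> 'p padic \<Rightarrow> ((vertex \<Rightarrow> nat) set \<Rightarrow> 'p padic) \<Rightarrow> bool" where
  "corresponding_measure q \<rho> i0 h \<mu> \<longleftrightarrow>
     fixed_point_solution q \<rho> h \<and> quasi_gibbs_measure q \<rho> (line_boundary i0 h) \<mu>"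

definition potts_A :: "nat \<Rightarrow> 'p::prime_card padic \<Rightarrow> 'p padic" where
  "potts_A q \<rho> = \<rho> ^ 3 - 3 * \<rho> - 3 * of_nat q + 5"

definition potts_B :: "nat \<Rightarrow> 'p::prime_card padic \<Rightarrow> 'p padic" where
  "potts_B q \<rho> = \<rho> * (\<rho> - 3) ^ 2 + 9 * of_nat q + 3 * \<rho> * of_nat q * (\<rho> - 2)
                 - 3 * of_nat q ^ 2 - 7"

definition potts_C :: "nat \<Rightarrow> 'p::prime_card padic" where
  "potts_C q = (of_nat q - 1) ^ 3"

end

theory Submission
  imports Defs
begin

text \<open>
  Summing out the outermost level of the tree turns a boundary function satisfying
  $\prod_{y} (\sum_j \rho^{\delta_{sj}} h_{j,y}) = d_x h_{s,x}$ (product over the successors \<open>y\<close> of \<open>x\<close>) into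
  a compatible family whose partition function is, up to a constant, the product of all \<open>d\<^sub>x\<close> in
  the ball. So the measure is unbounded as soon as $|d_x|_p \leq 1$ throughout and every level
  contains a vertex with $|d_x|_p \leq \varepsilon < 1$. For a root of the cubic this holds everywhere, because the cubic is
  a perturbation of $(x + q - 1)^3$.

  The phase transition does not need a root in $\mathbb{Q}_p$: a single branch of the
  recursion is the Moebius map $h \mapsto (\rho h + q - 1) / (h + \rho + q - 2)$, with fixed points
  \<open>1\<close> and \<open>1 - q\<close>. Putting \<open>1 - q\<close> on one ray through each successor of the root and \<open>1\<close>
  elsewhere gives an unbounded measure.
\<close>

section \<open>The norm of a p-adic number\<close>

lemma padic_norm_padic_lim:
  assumes "padic_Cauchy CARD('p) X" "(\<lambda>n. rat_padic_norm CARD('p) (X n)) \<longlonglongrightarrow> L"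
  shows "padic_norm (padic_lim X :: 'p::prime_card padic) = L"
  using padic_norm_lim[OF assms(1)] assms(2) by (rule LIMSEQ_unique)

lemma padic_norm_nonneg [simp]: "padic_norm (x :: 'p::prime_card padic) \<ge> 0"
proof -
  obtain X where X: "padic_Cauchy CARD('p) X" "x = padic_lim X" by (rule padic_cases)
  show ?thesis
    unfolding X(2) by (rule LIMSEQ_le_const[OF padic_norm_lim[OF X(1)]]) auto
qed

lemma padic_norm_eq_0_iff [simp]: "padic_norm x = 0 \<longleftrightarrow> x = (0 :: 'p::prime_card padic)"
proof -
  obtain X where X: "padic_Cauchy CARD('p) X" "x = padic_lim X" by (rule padic_cases)
  have "x = 0 \<longleftrightarrow> padic_null CARD('p) X"
    unfolding X(2) zero_padic_def
    by (subst padic_lim_eq_iff) (simp_all add: X(1) padic_Cauchy_const[OF prime_card])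
  also have "\<dots> \<longleftrightarrow> padic_norm x = 0"
    unfolding padic_null_def X(2) using padic_norm_lim[OF X(1)] LIMSEQ_unique by metis
  finally show ?thesis ..
qed

lemma padic_norm_mult [simp]: "padic_norm (x * y) = padic_norm x * padic_norm (y :: 'p::prime_card padic)"
proof -
  obtain X where X: "padic_Cauchy CARD('p) X" "x = padic_lim X" by (rule padic_cases)
  obtain Y where Y: "padic_Cauchy CARD('p) Y" "y = padic_lim Y" by (rule padic_cases)
  show ?thesis
    using tendsto_mult[OF padic_norm_lim[OF X(1)] padic_norm_lim[OF Y(1)]] X Y
    by (auto simp: padic_lim_mult rat_padic_norm_mult[OF prime_card]
        intro!: padic_norm_padic_lim padic_Cauchy_mult[OF prime_card])
qed

lemma padic_norm_ultra: "padic_norm (x + y) \<le> max (padic_norm x) (padic_norm (y :: 'p::prime_card padic))"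
proof -
  obtain X where X: "padic_Cauchy CARD('p) X" "x = padic_lim X" by (rule padic_cases)
  obtain Y where Y: "padic_Cauchy CARD('p) Y" "y = padic_lim Y" by (rule padic_cases)
  have "(\<lambda>n. rat_padic_norm CARD('p) (X n + Y n)) \<longlonglongrightarrow> padic_norm (x + y)"
    using padic_norm_lim[OF padic_Cauchy_add[OF prime_card X(1) Y(1)]] X Y by (simp add: padic_lim_add)
  moreover have "(\<lambda>n. max (rat_padic_norm CARD('p) (X n)) (rat_padic_norm CARD('p) (Y n)))
      \<longlonglongrightarrow> max (padic_norm x) (padic_norm y)"
    unfolding X(2) Y(2) by (intro tendsto_max padic_norm_lim X Y)
  ultimately show ?thesis
    by (rule LIMSEQ_le) (auto intro: rat_padic_norm_ultra[OF prime_card])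
qed

lemma padic_norm_0 [simp]: "padic_norm (0 :: 'p::prime_card padic) = 0"
  by simp

lemma padic_norm_1 [simp]: "padic_norm (1 :: 'p::prime_card padic) = 1"
  using padic_norm_of_rat[where 'p='p, of 1] by (simp add: prime_card)

lemma padic_norm_of_int_le_1: "padic_norm (of_int k :: 'p::prime_card padic) \<le> 1"
  using padic_norm_of_rat[where 'p='p, of "of_int k"]
    rat_padic_norm_of_int_le_1[OF prime_card[where 'a='p]] by simp

lemma padic_norm_minus [simp]: "padic_norm (- x) = padic_norm (x :: 'p::prime_card padic)"
proof -
  have "padic_norm (- 1 :: 'p padic) = 1"
    using padic_norm_of_rat[where 'p='p, of "- 1"]
    by (simp add: rat_padic_norm_minus[OF prime_card] prime_card of_rat_minus)
  thus ?thesis using padic_norm_mult[of "- 1" x] by simp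
qed

lemma padic_norm_power [simp]: "padic_norm (x ^ n) = padic_norm (x :: 'p::prime_card padic) ^ n"
  by (induction n) simp_all

lemma padic_norm_prod: "padic_norm (\<Prod>i\<in>A. f i :: 'p::prime_card padic) = (\<Prod>i\<in>A. padic_norm (f i))"
  by (induction A rule: infinite_finite_induct) simp_all

lemma padic_norm_divide [simp]:
  "padic_norm (x / y) = padic_norm x / padic_norm (y :: 'p::prime_card padic)"
proof (cases "y = 0")
  case False
  have "padic_norm (x / y) * padic_norm y = padic_norm x"
    using False by (simp flip: padic_norm_mult)
  with False show ?thesis by (simp add: field_simps)
qed simp

lemma padic_norm_add_le:
  fixes x y :: "'p::prime_card padic"
  shows "padic_norm x \<le> B \<Longrightarrow> padic_norm y \<le> B \<Longrightarrow> padic_norm (x + y) \<le> B"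
  using padic_norm_ultra[of x y] by linarith

lemma padic_norm_add_less:
  fixes x y :: "'p::prime_card padic"
  shows "padic_norm x < B \<Longrightarrow> padic_norm y < B \<Longrightarrow> padic_norm (x + y) < B"
  using padic_norm_ultra[of x y] by linarith

text \<open>The bound for \<open>x + y\<close> is one half; the other applies it to
  \<open>x = (x + y) - y\<close>, where \<open>y\<close> is too small to be the maximum.\<close>

lemma padic_norm_add_eq:
  fixes x y :: "'p::prime_card padic"
  assumes "padic_norm y < padic_norm x" shows "padic_norm (x + y) = padic_norm x"
  using padic_norm_ultra[of x y] padic_norm_ultra[of "x + y" "- y"] assms by auto

lemma padic_norm_sum_le:
  fixes f :: "'a \<Rightarrow> 'p::prime_card padic"
  assumes "\<And>i. i \<in> A \<Longrightarrow> padic_norm (f i) \<le> B" "B \<ge> 0"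
  shows "padic_norm (\<Sum>i\<in>A. f i) \<le> B"
  using assms by (induction A rule: infinite_finite_induct) (auto intro!: padic_norm_add_le)

section \<open>Summing out the outermost level\<close>

lemma mem_tree_level [simp]: "x \<in> tree_level n \<longleftrightarrow> length x = n"
  by (simp add: tree_level_def)

lemma mem_tree_ball [simp]: "x \<in> tree_ball n \<longleftrightarrow> length x \<le> n"
  by (auto simp: tree_ball_def)

lemma finite_tree_level [simp]: "finite (tree_level n)"
  using finite_lists_length_eq[of "UNIV :: 3 set" n] by (simp add: tree_level_def)

lemma finite_tree_ball [simp]: "finite (tree_ball n)"
  unfolding tree_ball_def by auto

lemma tree_ball_0: "tree_ball 0 = {[]}"
  by auto

lemma finite_configs [simp]: "finite A \<Longrightarrow> finite (configs q A)"
  unfolding configs_def by (rule finite_PiE) auto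

lemma prod_tree_level_Suc:
  fixes f :: "vertex \<Rightarrow> 'a::comm_monoid_mult"
  shows "(\<Prod>y\<in>tree_level (Suc n). f y) = (\<Prod>x\<in>tree_level n. \<Prod>i\<in>UNIV. f (i # x))"
proof -
  have "(\<Prod>y\<in>tree_level (Suc n). f y) = (\<Prod>(x, i)\<in>tree_level n \<times> UNIV. f (i # x))"
    by (rule prod.reindex_bij_witness[of _ "\<lambda>(x, i). i # x" "\<lambda>y. (tl y, hd y)"])
       (auto simp: length_Suc_conv)
  thus ?thesis by (simp add: prod.cartesian_product)
qed

lemma mem_tree_edges: "(x, y) \<in> tree_edges n \<longleftrightarrow> y \<noteq> [] \<and> x = tl y \<and> length y \<le> n"
  by (cases y) (auto simp: tree_edges_def)

lemma hamiltonian_0 [simp]: "hamiltonian 0 \<sigma> = 0"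
proof -
  have "tree_edges 0 = {}" by (auto simp: tree_edges_def)
  thus ?thesis by (simp add: hamiltonian_def)
qed

text \<open>A vertex \<open>y\<close> of the new level ends exactly one new edge, the one from its
  parent \<open>tl y\<close>, so the new vertices index the new edges.\<close>

lemma hamiltonian_Suc:
  "hamiltonian (Suc n) \<sigma> = hamiltonian n \<sigma> + (\<Sum>y\<in>tree_level (Suc n). of_bool (\<sigma> (tl y) = \<sigma> y))"
proof -
  let ?E = "(\<lambda>y :: vertex. (tl y, y)) ` tree_level (Suc n)"
  have eq: "tree_edges (Suc n) = tree_edges n \<union> ?E"
    by (auto simp: mem_tree_edges le_Suc_eq)
  have fin: "finite (tree_edges n)"
    by (rule finite_subset[of _ "tree_ball n \<times> tree_ball n"]) (auto simp: tree_edges_def)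
  have disj: "tree_edges n \<inter> ?E = {}" by (auto simp: tree_edges_def)
  have inj: "inj_on (\<lambda>y :: vertex. (tl y, y)) (tree_level (Suc n))" by (auto intro: inj_onI)
  show ?thesis
    unfolding hamiltonian_def eq
    by (subst sum.union_disjoint[OF fin _ disj]) (simp_all add: sum.reindex[OF inj])
qed

lemma hamiltonian_cong:
  assumes "\<And>x. x \<in> tree_ball n \<Longrightarrow> \<sigma> x = \<tau> x" shows "hamiltonian n \<sigma> = hamiltonian n \<tau>"
  unfolding hamiltonian_def by (rule sum.cong) (auto simp: tree_edges_def assms)

text \<open>Restricting to the ball and to the level inverts \<open>merge\<close>. The set
  \<open>S\<close> is general because the set of all configurations yields the recursion for the
  partition function, and the trace of an event yields the consistency of the measure.\<close>

lemma sum_configs_Suc: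
  assumes S: "S \<subseteq> configs q (tree_ball n)"
  shows "(\<Sum>\<tau> | \<tau> \<in> configs q (tree_ball (Suc n)) \<and> restrict \<tau> (tree_ball n) \<in> S. F \<tau>)
       = (\<Sum>\<sigma>\<in>S. \<Sum>\<omega>\<in>configs q (tree_level (Suc n)).
            F (merge (tree_ball n) (tree_level (Suc n)) (\<sigma>, \<omega>)))"
proof -
  let ?B = "tree_ball n" and ?W = "tree_level (Suc n)"
  have res: "restrict (merge ?B ?W (\<sigma>, \<omega>)) ?B = \<sigma>" if "\<sigma> \<in> S" for \<sigma> \<omega>
    using that S by (auto simp: configs_def PiE_iff restrict_def merge_def extensional_def fun_eq_iff)
  have "(\<Sum>\<tau> | \<tau> \<in> configs q (tree_ball (Suc n)) \<and> restrict \<tau> ?B \<in> S. F \<tau>)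
      = (\<Sum>(\<sigma>, \<omega>)\<in>S \<times> configs q ?W. F (merge ?B ?W (\<sigma>, \<omega>)))"
  proof (rule sum.reindex_bij_witness[of _ "merge ?B ?W" "\<lambda>\<tau>. (restrict \<tau> ?B, restrict \<tau> ?W)"];
      (elim SigmaE)?)
    fix \<tau> assume \<tau>: "\<tau> \<in> {\<tau> \<in> configs q (tree_ball (Suc n)). restrict \<tau> ?B \<in> S}"
    show *: "merge ?B ?W (restrict \<tau> ?B, restrict \<tau> ?W) = \<tau>"
      using \<tau> by (auto simp: configs_def PiE_iff merge_def extensional_def fun_eq_iff le_Suc_eq)
    show "(restrict \<tau> ?B, restrict \<tau> ?W) \<in> S \<times> configs q ?W"
      using \<tau> by (auto simp: configs_def PiE_iff)
    show "(case (restrict \<tau> ?B, restrict \<tau> ?W) of (\<sigma>, \<omega>) \<Rightarrow> F (merge ?B ?W (\<sigma>, \<omega>))) = F \<tau>"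
      by (simp only: prod.case *)
  next
    fix z \<sigma> \<omega> assume z: "z = (\<sigma>, \<omega>)" "\<sigma> \<in> S" "\<omega> \<in> configs q ?W"
    have "restrict (merge ?B ?W (\<sigma>, \<omega>)) ?W = \<omega>"
      using z by (auto simp: configs_def PiE_iff restrict_def merge_def extensional_def fun_eq_iff)
    thus "(restrict (merge ?B ?W z) ?B, restrict (merge ?B ?W z) ?W) = z"
      using z res by simp
    have "\<sigma> \<in> configs q ?B" using z S by auto
    hence "merge ?B ?W (\<sigma>, \<omega>) \<in> configs q (tree_ball (Suc n))"
      using z by (auto simp: configs_def PiE_iff merge_def extensional_def)
    thus "merge ?B ?W z \<in> {\<tau> \<in> configs q (tree_ball (Suc n)). restrict \<tau> ?B \<in> S}"
      using z res by simp
  qed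
  thus ?thesis by (simp add: sum.cartesian_product)
qed

text \<open>The total weight of the spin at \<open>y\<close> and of the edge above it, when the
  parent of \<open>y\<close> has spin \<open>s\<close>.\<close>

definition spin_transfer :: "nat \<Rightarrow> 'p::prime_card padic \<Rightarrow> 'p boundary \<Rightarrow> vertex \<Rightarrow> nat \<Rightarrow> 'p padic" where
  "spin_transfer q \<rho> h y s = (\<Sum>j<q. \<rho> ^ of_bool (s = j) * h y j)"

text \<open>Once the spins in the ball are fixed, each outermost spin interacts only with its
  parent. The sum therefore factors into independent sums, which are then grouped by
  parents.\<close>

lemma sum_gibbs_weight_Suc:
  "(\<Sum>\<omega>\<in>configs q (tree_level (Suc n)).
      gibbs_weight \<rho> h (Suc n) (merge (tree_ball n) (tree_level (Suc n)) (\<sigma>, \<omega>)))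
   = \<rho> ^ hamiltonian n \<sigma> * (\<Prod>x\<in>tree_level n. \<Prod>i\<in>UNIV. spin_transfer q \<rho> h (i # x) (\<sigma> x))"
proof -
  let ?W = "tree_level (Suc n)"
  let ?m = "\<lambda>\<omega>. merge (tree_ball n) ?W (\<sigma>, \<omega>)"
  have weight: "gibbs_weight \<rho> h (Suc n) (?m \<omega>)
      = \<rho> ^ hamiltonian n \<sigma> * (\<Prod>y\<in>?W. \<rho> ^ of_bool (\<sigma> (tl y) = \<omega> y) * h y (\<omega> y))" for \<omega>
  proof -
    have "hamiltonian n (?m \<omega>) = hamiltonian n \<sigma>"
      by (rule hamiltonian_cong) (simp add: merge_def)
    moreover have "(\<Sum>y\<in>?W. of_bool (?m \<omega> (tl y) = ?m \<omega> y)) = (\<Sum>y\<in>?W. of_bool (\<sigma> (tl y) = \<omega> y) :: nat)"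
      by (rule sum.cong) (auto simp: merge_def)
    moreover have "(\<Prod>y\<in>?W. h y (?m \<omega> y)) = (\<Prod>y\<in>?W. h y (\<omega> y))"
      by (rule prod.cong) (auto simp: merge_def)
    ultimately show ?thesis
      by (simp only: gibbs_weight_def hamiltonian_Suc power_add power_sum prod.distrib mult.assoc)
  qed
  have "(\<Sum>\<omega>\<in>configs q ?W. \<Prod>y\<in>?W. \<rho> ^ of_bool (\<sigma> (tl y) = \<omega> y) * h y (\<omega> y))
      = (\<Prod>y\<in>?W. spin_transfer q \<rho> h y (\<sigma> (tl y)))"
    unfolding configs_def spin_transfer_def lessThan_atLeast0 by (subst prod_sum_PiE) auto
  also have "\<dots> = (\<Prod>x\<in>tree_level n. \<Prod>i\<in>UNIV. spin_transfer q \<rho> h (i # x) (\<sigma> x))"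
    by (simp add: prod_tree_level_Suc)
  finally show ?thesis by (simp add: weight flip: sum_distrib_left)
qed

section \<open>Compatible boundary functions\<close>

text \<open>The equation is imposed at the root too, although no weight with
  \<open>n \<ge> 1\<close> involves \<open>h []\<close>. These values are thus free, and choosing
  them by the equation lets the recursion start from the one-vertex ball.\<close>

definition boundary_law ::
  "nat \<Rightarrow> 'p::prime_card padic \<Rightarrow> 'p boundary \<Rightarrow> (vertex \<Rightarrow> 'p padic) \<Rightarrow> bool" where
  "boundary_law q \<rho> h d \<longleftrightarrow>
     (\<forall>x. d x \<noteq> 0 \<and> (\<forall>s<q. (\<Prod>i\<in>UNIV. spin_transfer q \<rho> h (i # x) s) = d x * h x s))"

lemma sum_gibbs_weight_boundary_law:
  assumes law: "boundary_law q \<rho> h d" and \<sigma>: "\<sigma> \<in> configs q (tree_ball n)"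
  shows "(\<Sum>\<omega>\<in>configs q (tree_level (Suc n)).
      gibbs_weight \<rho> h (Suc n) (merge (tree_ball n) (tree_level (Suc n)) (\<sigma>, \<omega>)))
   = (\<Prod>x\<in>tree_level n. d x) * gibbs_weight \<rho> h n \<sigma>"
proof -
  have "\<sigma> x < q" if "x \<in> tree_level n" for x
    using \<sigma> that by (auto simp: configs_def PiE_iff)
  hence "(\<Prod>x\<in>tree_level n. \<Prod>i\<in>UNIV. spin_transfer q \<rho> h (i # x) (\<sigma> x))
      = (\<Prod>x\<in>tree_level n. d x * h x (\<sigma> x))"
    using law by (intro prod.cong) (auto simp: boundary_law_def)
  thus ?thesis
    unfolding sum_gibbs_weight_Suc by (simp add: gibbs_weight_def prod.distrib)
qed

lemma partition_function_Suc:
  assumes "boundary_law q \<rho> h d"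
  shows "partition_function q \<rho> h (Suc n) = (\<Prod>x\<in>tree_level n. d x) * partition_function q \<rho> h n"
proof -
  have "restrict \<tau> (tree_ball n) \<in> configs q (tree_ball n)" if "\<tau> \<in> configs q (tree_ball (Suc n))" for \<tau>
    using that by (auto simp: configs_def PiE_iff)
  hence "configs q (tree_ball (Suc n))
      = {\<tau>. \<tau> \<in> configs q (tree_ball (Suc n)) \<and> restrict \<tau> (tree_ball n) \<in> configs q (tree_ball n)}"
    by auto
  thus ?thesis
    unfolding partition_function_def
    using sum_configs_Suc[of "configs q (tree_ball n)" q n "gibbs_weight \<rho> h (Suc n)"]
    by (simp add: sum_gibbs_weight_boundary_law[OF assms] sum_distrib_left)
qed

lemma partition_function_0: "partition_function q \<rho> h 0 = (\<Sum>s<q. h [] s)"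
proof -
  have "tree_level 0 = {[]}" by auto
  hence "partition_function q \<rho> h 0 = (\<Sum>\<sigma>\<in>{[]} \<rightarrow>\<^sub>E {0..<q}. \<Prod>x\<in>{[]}. h x (\<sigma> x))"
    by (simp add: partition_function_def gibbs_weight_def configs_def tree_ball_0)
  also have "\<dots> = (\<Prod>x\<in>{[]}. \<Sum>s\<in>{0..<q}. h x s)"
    by (rule prod_sum_PiE[symmetric]) auto
  finally show ?thesis by (simp add: lessThan_atLeast0)
qed

lemma partition_function_eq:
  assumes "boundary_law q \<rho> h d"
  shows "partition_function q \<rho> h n = (\<Sum>s<q. h [] s) * (\<Prod>m<n. \<Prod>x\<in>tree_level m. d x)"
  by (induction n) (simp_all add: partition_function_0 partition_function_Suc[OF assms])

text \<open>Summing out a level multiplies the weights and the partition function by the same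
  product of the \<open>d x\<close>, which cancels in the quotient. By \<open>nz\<close> the
  partition function of the one-vertex ball is nonzero, and the nonzero factors carry this to all
  radii.\<close>

lemma compatible_boundary_law:
  assumes law: "boundary_law q \<rho> h d" and nz: "(\<Sum>s<q. h [] s) \<noteq> 0"
  shows "compatible q \<rho> h"
  unfolding compatible_def
proof (intro conjI allI impI ballI)
  have d: "(\<Prod>x\<in>tree_level m. d x) \<noteq> 0" for m
    using law by (simp add: boundary_law_def)
  fix n :: nat
  show "partition_function q \<rho> h n \<noteq> 0"
    using d nz by (simp add: partition_function_eq[OF law])
  assume "n \<ge> 2"
  then obtain m where n: "n = Suc m" by (cases n) auto
  fix \<sigma> assume "\<sigma> \<in> configs q (tree_ball (n - 1))"
  hence "\<sigma> \<in> configs q (tree_ball m)" by (simp add: n)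
  thus "(\<Sum>\<omega>\<in>configs q (tree_level n).
           finite_volume_measure q \<rho> h n (merge (tree_ball (n - 1)) (tree_level n) (\<sigma>, \<omega>)))
        = finite_volume_measure q \<rho> h (n - 1) \<sigma>"
    using d[of m]
    by (simp add: n finite_volume_measure_def partition_function_Suc[OF law]
        sum_gibbs_weight_boundary_law[OF law] flip: sum_divide_distrib)
qed

section \<open>The measure of a compatible boundary function\<close>

definition cylinders :: "nat \<Rightarrow> nat \<Rightarrow> (vertex \<Rightarrow> nat) set set" where
  "cylinders q n = cylinder q n ` Pow (configs q (tree_ball n))"

text \<open>For \<open>q > 0\<close> this recovers the base of a cylinder from the event, inverting
  \<open>cylinder q n\<close>.\<close>

definition trace_on_ball :: "nat \<Rightarrow> (vertex \<Rightarrow> nat) set \<Rightarrow> (vertex \<Rightarrow> nat) set" where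
  "trace_on_ball n A = (\<lambda>\<sigma>. restrict \<sigma> (tree_ball n)) ` A"

lemma cylinder_algebra_eq: "cylinder_algebra q = (\<Union>n. cylinders q n)"
  by (auto simp: cylinder_algebra_def cylinders_def)

lemma trace_on_ball_subset:
  "A \<subseteq> configs q UNIV \<Longrightarrow> trace_on_ball n A \<subseteq> configs q (tree_ball n)"
  by (auto simp: trace_on_ball_def configs_def PiE_iff subset_iff)

text \<open>Without reference to a base, monotonicity in \<open>n\<close> and stability under unions
  and complements can be read off directly.\<close>

lemma cylinders_iff:
  "A \<in> cylinders q n \<longleftrightarrow> A \<subseteq> configs q UNIV \<and>
     (\<forall>\<sigma>\<in>A. \<forall>\<tau>\<in>configs q UNIV. (\<forall>x\<in>tree_ball n. \<sigma> x = \<tau> x) \<longrightarrow> \<tau> \<in> A)" (is "?L \<longleftrightarrow> ?R")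
proof
  assume ?L
  then obtain S where A: "A = cylinder q n S" by (auto simp: cylinders_def)
  have "restrict \<sigma> (tree_ball n) = restrict \<tau> (tree_ball n)"
    if "\<forall>x\<in>tree_ball n. \<sigma> x = \<tau> x" for \<sigma> \<tau> :: "vertex \<Rightarrow> nat"
    using that by (intro restrict_ext) auto
  thus ?R unfolding A cylinder_def by fastforce
next
  assume R: ?R
  have "A = cylinder q n (trace_on_ball n A)"
  proof
    show "A \<subseteq> cylinder q n (trace_on_ball n A)"
      using R by (auto simp: cylinder_def trace_on_ball_def)
    show "cylinder q n (trace_on_ball n A) \<subseteq> A"
    proof
      fix \<tau> assume "\<tau> \<in> cylinder q n (trace_on_ball n A)"
      then obtain \<sigma> where \<sigma>: "\<sigma> \<in> A" "restrict \<tau> (tree_ball n) = restrict \<sigma> (tree_ball n)"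
        and \<tau>: "\<tau> \<in> configs q UNIV"
        by (auto simp: cylinder_def trace_on_ball_def)
      have "\<forall>x\<in>tree_ball n. \<sigma> x = \<tau> x"
        using \<sigma>(2) by (metis restrict_apply)
      thus "\<tau> \<in> A" using R \<sigma>(1) \<tau> by blast
    qed
  qed
  thus ?L using R trace_on_ball_subset unfolding cylinders_def by blast
qed

lemma cylinders_mono: "m \<le> n \<Longrightarrow> cylinders q m \<subseteq> cylinders q n"
  by (auto simp: cylinders_iff)

lemma cylinders_UNIV: "configs q UNIV \<in> cylinders q n"
  by (auto simp: cylinders_iff)

lemma cylinder_algebraE:
  assumes "A \<in> cylinder_algebra q" obtains n where "n \<ge> 1" "A \<in> cylinders q n"
proof -
  obtain m where "A \<in> cylinders q m" using assms by (auto simp: cylinder_algebra_eq)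
  hence "A \<in> cylinders q (max 1 m)" using cylinders_mono[of m "max 1 m" q] by auto
  thus thesis using that[of "max 1 m"] by simp
qed

lemma algebra_cylinder_algebra: "Sigma_Algebra.algebra (configs q UNIV) (cylinder_algebra q)"
  unfolding algebra_iff_Un
proof (intro conjI ballI)
  show "cylinder_algebra q \<subseteq> Pow (configs q UNIV)"
    by (auto simp: cylinder_algebra_eq cylinders_iff)
  show "{} \<in> cylinder_algebra q"
    by (auto simp: cylinder_algebra_eq cylinders_iff)
  fix A assume "A \<in> cylinder_algebra q"
  then obtain m where A: "A \<in> cylinders q m" by (rule cylinder_algebraE)
  have "configs q UNIV - A \<in> cylinders q m"
    unfolding cylinders_iff
  proof (intro conjI ballI impI)
    fix \<sigma> \<tau> assume "\<sigma> \<in> configs q UNIV - A" "\<tau> \<in> configs q UNIV" "\<forall>x\<in>tree_ball m. \<sigma> x = \<tau> x"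
    thus "\<tau> \<in> configs q UNIV - A" using A unfolding cylinders_iff by (metis Diff_iff)
  qed auto
  thus "configs q UNIV - A \<in> cylinder_algebra q" by (auto simp: cylinder_algebra_eq)
  fix B assume "B \<in> cylinder_algebra q"
  then obtain n where B: "B \<in> cylinders q n" by (rule cylinder_algebraE)
  have "A \<in> cylinders q (max m n)" "B \<in> cylinders q (max m n)"
    using A B cylinders_mono[of m "max m n" q] cylinders_mono[of n "max m n" q] by auto
  hence "A \<union> B \<in> cylinders q (max m n)" unfolding cylinders_iff by blast
  thus "A \<union> B \<in> cylinder_algebra q" by (auto simp: cylinder_algebra_eq)
qed

lemma config_extension:
  assumes "q > 0" "\<sigma> \<in> configs q B"
  obtains \<tau> where "\<tau> \<in> configs q UNIV" "restrict \<tau> B = \<sigma>"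
proof
  show "(\<lambda>x. if x \<in> B then \<sigma> x else 0) \<in> configs q UNIV"
    using assms by (auto simp: configs_def PiE_iff)
  show "restrict (\<lambda>x. if x \<in> B then \<sigma> x else 0) B = \<sigma>"
    using assms by (auto simp: configs_def PiE_iff extensional_def fun_eq_iff)
qed

lemma trace_on_ball_cylinder:
  assumes "q > 0" "S \<subseteq> configs q (tree_ball n)"
  shows "trace_on_ball n (cylinder q n S) = S"
proof
  show "S \<subseteq> trace_on_ball n (cylinder q n S)"
  proof
    fix \<sigma> assume "\<sigma> \<in> S"
    moreover obtain \<tau> where "\<tau> \<in> configs q UNIV" "restrict \<tau> (tree_ball n) = \<sigma>"
      using config_extension[OF assms(1)] assms(2) \<open>\<sigma> \<in> S\<close> by blast
    ultimately show "\<sigma> \<in> trace_on_ball n (cylinder q n S)"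
      by (auto simp: trace_on_ball_def cylinder_def)
  qed
qed (auto simp: trace_on_ball_def cylinder_def)

lemma cylinder_trace_on_ball:
  assumes "q > 0" "A \<in> cylinders q n"
  shows "cylinder q n (trace_on_ball n A) = A"
  using assms by (auto simp: cylinders_def trace_on_ball_cylinder)

text \<open>An event decided on the smaller ball puts no constraint on the spins of the new
  level.\<close>

lemma trace_on_ball_Suc:
  assumes "q > 0" and A: "A \<in> cylinders q n"
  shows "trace_on_ball (Suc n) A
       = {\<tau>. \<tau> \<in> configs q (tree_ball (Suc n)) \<and> restrict \<tau> (tree_ball n) \<in> trace_on_ball n A}"
    (is "?L = ?R")
proof
  have res: "restrict (restrict \<sigma> (tree_ball (Suc n))) (tree_ball n) = restrict \<sigma> (tree_ball n)"
    for \<sigma> :: "vertex \<Rightarrow> nat" by (auto simp: restrict_def)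
  have "?L \<subseteq> configs q (tree_ball (Suc n))"
    using A by (intro trace_on_ball_subset) (simp add: cylinders_iff)
  moreover have "restrict \<tau> (tree_ball n) \<in> trace_on_ball n A" if "\<tau> \<in> ?L" for \<tau>
    using that res unfolding trace_on_ball_def by fastforce
  ultimately show "?L \<subseteq> ?R" by blast
  show "?R \<subseteq> ?L"
  proof
    fix \<tau> assume \<tau>: "\<tau> \<in> ?R"
    obtain \<tau>' where \<tau>': "\<tau>' \<in> configs q UNIV" "restrict \<tau>' (tree_ball (Suc n)) = \<tau>"
      using config_extension[OF assms(1)] \<tau> by blast
    hence "\<tau>' \<in> cylinder q n (trace_on_ball n A)"
      using \<tau> res by (auto simp: cylinder_def)
    thus "\<tau> \<in> ?L"
      using \<tau>' cylinder_trace_on_ball[OF assms] by (auto simp: trace_on_ball_def)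
  qed
qed

definition trace_sum ::
  "nat \<Rightarrow> 'p::prime_card padic \<Rightarrow> 'p boundary \<Rightarrow> nat \<Rightarrow> (vertex \<Rightarrow> nat) set \<Rightarrow> 'p padic" where
  "trace_sum q \<rho> h n A = (\<Sum>\<sigma>\<in>trace_on_ball n A. finite_volume_measure q \<rho> h n \<sigma>)"

text \<open>The trace on the larger ball consists of all extensions of the smaller trace, so
  compatibility sums out the new level.\<close>

lemma trace_sum_Suc:
  assumes "q > 0" "compatible q \<rho> h" "n \<ge> 1" and A: "A \<in> cylinders q n"
  shows "trace_sum q \<rho> h (Suc n) A = trace_sum q \<rho> h n A"
proof -
  have S: "trace_on_ball n A \<subseteq> configs q (tree_ball n)"
    using A by (intro trace_on_ball_subset) (simp add: cylinders_iff)
  have step: "\<forall>\<sigma>\<in>configs q (tree_ball (Suc n - 1)).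
      (\<Sum>\<omega>\<in>configs q (tree_level (Suc n)). finite_volume_measure q \<rho> h (Suc n)
         (merge (tree_ball (Suc n - 1)) (tree_level (Suc n)) (\<sigma>, \<omega>)))
      = finite_volume_measure q \<rho> h (Suc n - 1) \<sigma>"
    by (intro ballI, rule assms(2)[unfolded compatible_def, THEN conjunct2, rule_format])
       (use assms(3) in auto)
  show ?thesis
    unfolding trace_sum_def trace_on_ball_Suc[OF assms(1) A] sum_configs_Suc[OF S]
    using S step by (intro sum.cong) auto
qed

lemma trace_sum_mono:
  assumes "q > 0" "compatible q \<rho> h" "n \<ge> 1" "A \<in> cylinders q n" "m \<ge> n"
  shows "trace_sum q \<rho> h m A = trace_sum q \<rho> h n A"
  using assms(5)
proof (induction m rule: dec_induct)
  case (step m)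
  thus ?case using assms cylinders_mono[of n m q] by (subst trace_sum_Suc) auto
qed simp

lemma finite_trace_on_ball:
  "A \<in> cylinders q n \<Longrightarrow> finite (trace_on_ball n A)"
  by (rule finite_subset[OF trace_on_ball_subset[of A q]]) (auto simp: cylinders_iff)

lemma trace_sum_Un:
  assumes A: "A \<in> cylinders q n" and B: "B \<in> cylinders q n" and disj: "A \<inter> B = {}"
  shows "trace_sum q \<rho> h n (A \<union> B) = trace_sum q \<rho> h n A + trace_sum q \<rho> h n B"
proof -
  have "trace_on_ball n A \<inter> trace_on_ball n B = {}"
  proof (rule ccontr)
    assume "trace_on_ball n A \<inter> trace_on_ball n B \<noteq> {}"
    then obtain \<sigma> \<tau> where st: "\<sigma> \<in> A" "\<tau> \<in> B" "restrict \<sigma> (tree_ball n) = restrict \<tau> (tree_ball n)"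
      by (auto simp: trace_on_ball_def)
    have "\<forall>x\<in>tree_ball n. \<sigma> x = \<tau> x" using st(3) by (metis restrict_apply)
    hence "\<tau> \<in> A" using st A B by (auto simp: cylinders_iff)
    thus False using st disj by auto
  qed
  moreover have "trace_on_ball n (A \<union> B) = trace_on_ball n A \<union> trace_on_ball n B"
    by (simp add: trace_on_ball_def image_Un)
  ultimately show ?thesis
    using finite_trace_on_ball[OF A] finite_trace_on_ball[OF B]
    by (simp add: trace_sum_def sum.union_disjoint)
qed

text \<open>The measure of an event is the sum over its trace on any ball that decides it;
  compatibility makes the choice of ball irrelevant. For additivity both events are placed on a
  common ball, where disjoint events have disjoint traces.\<close>

lemma ex_quasi_gibbs_measure:
  assumes q: "q > 0" and h: "\<And>x. x \<noteq> [] \<Longrightarrow> h x 0 = 1" and c: "compatible q \<rho> h"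
  shows "\<exists>\<mu>. quasi_gibbs_measure q \<rho> h \<mu>"
proof -
  define \<mu> where "\<mu> A = trace_sum q \<rho> h (SOME n. n \<ge> 1 \<and> A \<in> cylinders q n) A" for A
  have \<mu>: "\<mu> A = trace_sum q \<rho> h n A" if "n \<ge> 1" "A \<in> cylinders q n" for A n
  proof -
    define m where "m = (SOME n. n \<ge> 1 \<and> A \<in> cylinders q n)"
    have m: "m \<ge> 1 \<and> A \<in> cylinders q m"
      unfolding m_def by (rule someI[of _ n]) (use that in auto)
    show ?thesis
      unfolding \<mu>_def m_def[symmetric]
      using trace_sum_mono[OF q c that, of "max m n"] trace_sum_mono[OF q c, of m A "max m n"] m
      by simp
  qed
  have "additive (cylinder_algebra q) \<mu>"
    unfolding additive_def
  proof (intro ballI impI)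
    fix A B assume AB: "A \<in> cylinder_algebra q" "B \<in> cylinder_algebra q" "A \<inter> B = {}"
    obtain m where m: "m \<ge> 1" "A \<in> cylinders q m" using AB(1) by (rule cylinder_algebraE)
    obtain n where n: "n \<ge> 1" "B \<in> cylinders q n" using AB(2) by (rule cylinder_algebraE)
    let ?k = "max m n"
    have k: "?k \<ge> 1" "A \<in> cylinders q ?k" "B \<in> cylinders q ?k"
      using m n cylinders_mono[of m ?k q] cylinders_mono[of n ?k q] by auto
    hence "A \<union> B \<in> cylinders q ?k" unfolding cylinders_iff by blast
    thus "\<mu> (A \<union> B) = \<mu> A + \<mu> B"
      using k AB(3) by (simp add: \<mu>[of ?k] trace_sum_Un del: max.bounded_iff)
  qed
  moreover have "\<mu> (configs q UNIV) = 1"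
  proof -
    have "cylinder q 1 (configs q (tree_ball 1)) = configs q UNIV"
      by (auto simp: cylinder_def configs_def)
    hence "trace_on_ball 1 (configs q UNIV) = configs q (tree_ball 1)"
      using trace_on_ball_cylinder[OF q, of "configs q (tree_ball 1)" 1] by simp
    hence "\<mu> (configs q UNIV) = (\<Sum>\<sigma>\<in>configs q (tree_ball 1). finite_volume_measure q \<rho> h 1 \<sigma>)"
      using \<mu>[of 1] cylinders_UNIV[of q 1] by (simp add: trace_sum_def)
    also have "\<dots> = partition_function q \<rho> h 1 / partition_function q \<rho> h 1"
      by (simp add: finite_volume_measure_def partition_function_def flip: sum_divide_distrib)
    finally show ?thesis using c by (simp add: compatible_def)
  qed
  moreover have "\<mu> (cylinder q n {\<sigma>}) = finite_volume_measure q \<rho> h n \<sigma>"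
    if "n \<ge> 1" "\<sigma> \<in> configs q (tree_ball n)" for n \<sigma>
  proof -
    have "cylinder q n {\<sigma>} \<in> cylinders q n" using that(2) by (auto simp: cylinders_def)
    thus ?thesis
      using that q by (simp add: \<mu>[OF that(1)] trace_sum_def trace_on_ball_cylinder)
  qed
  ultimately show ?thesis
    using h c algebra_cylinder_algebra
    by (auto simp: quasi_gibbs_measure_def padic_prob_measure_def)
qed

text \<open>The definition of \<open>quasi_gibbs_measure\<close> prescribes values on single
  configurations only; since \<open>S\<close> is finite, additivity determines the rest.\<close>

lemma quasi_gibbs_measure_cylinder:
  assumes \<mu>: "quasi_gibbs_measure q \<rho> h \<mu>" and "n \<ge> 1" "S \<subseteq> configs q (tree_ball n)"
  shows "\<mu> (cylinder q n S) = (\<Sum>\<sigma>\<in>S. finite_volume_measure q \<rho> h n \<sigma>)"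
proof -
  have add: "\<mu> (A \<union> B) = \<mu> A + \<mu> B"
    if "A \<in> cylinder_algebra q" "B \<in> cylinder_algebra q" "A \<inter> B = {}" for A B
    using \<mu> that by (auto simp: quasi_gibbs_measure_def padic_prob_measure_def additive_def)
  have cyl: "cylinder q n T \<in> cylinder_algebra q" if "T \<subseteq> configs q (tree_ball n)" for T
    using that by (auto simp: cylinder_algebra_def)
  have "finite S" using assms(3) by (rule finite_subset) simp
  thus ?thesis using assms(3)
  proof (induction S rule: finite_induct)
    case empty
    \<comment> \<open>Additivity for the disjoint pair \<open>{}\<close>, \<open>{}\<close> reads
      \<open>\<mu> {} = \<mu> {} + \<mu> {}\<close>, which forces the value
      \<open>0\<close>.\<close>
    show ?case using add[of "{}" "{}"] cyl[of "{}"] by (simp add: cylinder_def)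
  next
    case (insert \<sigma> S)
    have "cylinder q n (insert \<sigma> S) = cylinder q n {\<sigma>} \<union> cylinder q n S"
      "cylinder q n {\<sigma>} \<inter> cylinder q n S = {}"
      using insert.hyps by (auto simp: cylinder_def)
    hence "\<mu> (cylinder q n (insert \<sigma> S)) = \<mu> (cylinder q n {\<sigma>}) + \<mu> (cylinder q n S)"
      using add cyl insert.prems by simp
    thus ?case
      using insert \<mu> \<open>n \<ge> 1\<close> by (simp add: quasi_gibbs_measure_def)
  qed
qed

section \<open>Boundedness\<close>

text \<open>By the ultrametric inequality a finite sum is no larger than its largest term, so a
  bound on single configurations bounds every event, however large its base.\<close>

lemma padic_bounded_quasi_gibbs_measure:
  assumes \<mu>: "quasi_gibbs_measure q \<rho> h \<mu>"
    and B: "B \<ge> 0" "\<And>n \<sigma>. n \<ge> 1 \<Longrightarrow> \<sigma> \<in> configs q (tree_ball n) \<Longrightarrow>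
      padic_norm (finite_volume_measure q \<rho> h n \<sigma>) \<le> B"
  shows "padic_bounded (cylinder_algebra q) \<mu>"
  unfolding padic_bounded_def
proof (rule bdd_aboveI2)
  fix A assume "A \<in> cylinder_algebra q"
  then obtain n where n: "n \<ge> 1" "A \<in> cylinders q n" by (rule cylinder_algebraE)
  then obtain S where S: "S \<subseteq> configs q (tree_ball n)" "A = cylinder q n S"
    by (auto simp: cylinders_def)
  show "padic_norm (\<mu> A) \<le> B"
    unfolding S(2) quasi_gibbs_measure_cylinder[OF \<mu> n(1) S(1)]
    using S(1) B n(1) by (intro padic_norm_sum_le) auto
qed

lemma prod_le_factor:
  fixes f :: "'a \<Rightarrow> real"
  assumes "finite A" "a \<in> A" "\<And>x. x \<in> A \<Longrightarrow> 0 \<le> f x \<and> f x \<le> 1"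
  shows "prod f A \<le> f a"
proof -
  have "prod f A = f a * prod f (A - {a})" using assms by (simp add: prod.remove)
  also have "\<dots> \<le> f a * 1" using assms by (intro mult_left_mono prod_le_1) auto
  finally show ?thesis by simp
qed

text \<open>
  The constant configuration \<open>0\<close> has weight of norm \<open>1\<close>, while every level multiplies the
  partition function by a factor of norm at most \<open>\<epsilon>\<close>.
\<close>

lemma not_padic_bounded_boundary_law:
  fixes d :: "vertex \<Rightarrow> 'p::prime_card padic"
  assumes \<mu>: "quasi_gibbs_measure q \<rho> h \<mu>" and law: "boundary_law q \<rho> h d"
    and q: "q > 0" and \<rho>: "padic_norm \<rho> = 1"
    and d: "\<And>x. padic_norm (d x) \<le> 1" "\<And>m. \<exists>x\<in>tree_level m. padic_norm (d x) \<le> \<epsilon>" and \<epsilon>: "\<epsilon> < 1"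
  shows "\<not> padic_bounded (cylinder_algebra q) \<mu>"
proof
  assume "padic_bounded (cylinder_algebra q) \<mu>"
  then obtain B where B: "\<And>A. A \<in> cylinder_algebra q \<Longrightarrow> padic_norm (\<mu> A) \<le> B"
    by (auto simp: padic_bounded_def bdd_above_def)
  have h: "\<And>x. x \<noteq> [] \<Longrightarrow> h x 0 = 1" and Z: "\<And>n. n \<ge> 1 \<Longrightarrow> partition_function q \<rho> h n \<noteq> 0"
    using \<mu> by (auto simp: quasi_gibbs_measure_def compatible_def)
  define K where "K = padic_norm (\<Sum>s<q. h [] s)"
  have \<epsilon>0: "\<epsilon> \<ge> 0" using d(2)[of 0] padic_norm_nonneg order_trans by blast
  have level: "padic_norm (\<Prod>x\<in>tree_level m. d x) \<le> \<epsilon>" for m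
  proof -
    obtain x where x: "x \<in> tree_level m" "padic_norm (d x) \<le> \<epsilon>" using d(2) by blast
    have "padic_norm (\<Prod>x\<in>tree_level m. d x) \<le> padic_norm (d x)"
      unfolding padic_norm_prod by (rule prod_le_factor) (use x d(1) in auto)
    thus ?thesis using x(2) by simp
  qed
  have Z_le: "padic_norm (partition_function q \<rho> h n) \<le> K * \<epsilon> ^ n" for n
  proof -
    have "(\<Prod>m<n. padic_norm (\<Prod>x\<in>tree_level m. d x)) \<le> (\<Prod>m<n. \<epsilon>)"
      by (rule prod_mono) (use level in auto)
    thus ?thesis
      by (auto simp: partition_function_eq[OF law] padic_norm_prod K_def intro!: mult_left_mono)
  qed
  \<comment> \<open>The cylinder of the zero configuration has measure of norm
    \<open>1 / padic_norm (partition_function q \<rho> h n)\<close>, so the bound \<open>B\<close>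
    keeps the partition functions away from \<open>0\<close>; for large \<open>n\<close> this
    contradicts \<open>Z_le\<close>.\<close>
  have one_le: "1 \<le> B * (K * \<epsilon> ^ n)" if n: "n \<ge> 1" for n
  proof -
    define \<sigma> :: "vertex \<Rightarrow> nat" where "\<sigma> = restrict (\<lambda>_. 0) (tree_ball n)"
    have \<sigma>: "\<sigma> \<in> configs q (tree_ball n)" using q by (auto simp: \<sigma>_def configs_def)
    \<comment> \<open>As \<open>n \<ge> 1\<close>, the root is not on this level, so the
      normalization of spin \<open>0\<close> applies.\<close>
    have "h x (\<sigma> x) = 1" if "x \<in> tree_level n" for x
      using h[of x] n that by (cases "x = []") (auto simp: \<sigma>_def)
    hence "padic_norm (gibbs_weight \<rho> h n \<sigma>) = 1"
      by (simp add: gibbs_weight_def \<rho>)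
    moreover have le_B: "padic_norm (finite_volume_measure q \<rho> h n \<sigma>) \<le> B"
    proof -
      have "cylinder q n {\<sigma>} \<in> cylinder_algebra q" using \<sigma> by (auto simp: cylinder_algebra_def)
      from B[OF this] show ?thesis using \<mu> \<sigma> n by (simp add: quasi_gibbs_measure_def)
    qed
    moreover have "padic_norm (partition_function q \<rho> h n) > 0"
      using Z[OF n] by (simp add: less_le)
    ultimately have *: "1 \<le> B * padic_norm (partition_function q \<rho> h n)"
      by (simp add: finite_volume_measure_def divide_le_eq)
    have "B \<ge> 0" using padic_norm_nonneg le_B by (rule order_trans)
    hence "B * padic_norm (partition_function q \<rho> h n) \<le> B * (K * \<epsilon> ^ n)"
      by (intro mult_left_mono Z_le)
    with * show ?thesis by linarith
  qed
  have "(\<lambda>n. B * (K * \<epsilon> ^ n)) \<longlonglongrightarrow> B * (K * 0)"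
    by (intro tendsto_mult tendsto_const LIMSEQ_realpow_zero \<epsilon> \<epsilon>0)
  hence "1 \<le> B * (K * 0)"
    by (rule LIMSEQ_le_const) (use one_le in blast)
  thus False by simp
qed

section \<open>Boundary functions on the line\<close>

text \<open>A site-dependent \<open>line_boundary\<close>, serving both the translation-invariant
  measures and the measure built from rays.\<close>

definition spin_boundary :: "nat \<Rightarrow> (vertex \<Rightarrow> 'p::prime_card padic) \<Rightarrow> 'p boundary" where
  "spin_boundary i0 g = (\<lambda>x i. if i = i0 then g x else 1)"

lemma line_boundary_eq: "line_boundary i0 h = spin_boundary i0 (\<lambda>_. h)"
  by (simp add: line_boundary_def spin_boundary_def)

lemma sum_spin_boundary:
  assumes "i0 < q"
  shows "(\<Sum>j<q. spin_boundary i0 g y j) = g y + of_nat q - 1"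
proof -
  have "(\<Sum>j<q. spin_boundary i0 g y j) = (\<Sum>j<q. 1 + (if j = i0 then g y - 1 else 0))"
    by (rule sum.cong) (auto simp: spin_boundary_def)
  thus ?thesis using assms by (simp add: sum.distrib)
qed

lemma spin_transfer_eq:
  assumes "s < q"
  shows "spin_transfer q \<rho> h y s = (\<Sum>j<q. h y j) + (\<rho> - 1) * h y s"
proof -
  have "spin_transfer q \<rho> h y s = (\<Sum>j<q. h y j + (if j = s then (\<rho> - 1) * h y s else 0))"
    unfolding spin_transfer_def by (rule sum.cong) (auto simp: algebra_simps)
  thus ?thesis using assms by (simp add: sum.distrib)
qed

definition line_denom :: "nat \<Rightarrow> 'p::prime_card padic \<Rightarrow> (vertex \<Rightarrow> 'p padic) \<Rightarrow> vertex \<Rightarrow> 'p padic" where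
  "line_denom q \<rho> g x = (\<Prod>i\<in>UNIV. g (i # x) + \<rho> + of_nat q - 2)"

text \<open>The spin transfer depends only on whether \<open>s = i0\<close>. For
  \<open>s \<noteq> i0\<close> the law forces the factor to be \<open>line_denom\<close>; for
  \<open>s = i0\<close> it is then the hypothesis \<open>g\<close>.\<close>

lemma boundary_law_spin_boundary:
  assumes i0: "i0 < q"
    and "\<And>x i. g (i # x) + \<rho> + of_nat q - 2 \<noteq> 0"
    and g: "\<And>x. g x * line_denom q \<rho> g x = (\<Prod>i\<in>UNIV. \<rho> * g (i # x) + of_nat q - 1)"
  shows "boundary_law q \<rho> (spin_boundary i0 g) (line_denom q \<rho> g)"
  unfolding boundary_law_def
proof (intro allI conjI impI)
  fix x s assume s: "s < q"
  have "spin_transfer q \<rho> (spin_boundary i0 g) (i # x) s =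
      (if s = i0 then \<rho> * g (i # x) + of_nat q - 1 else g (i # x) + \<rho> + of_nat q - 2)" for i
    unfolding spin_transfer_eq[OF s] sum_spin_boundary[OF i0]
    by (auto simp: spin_boundary_def algebra_simps)
  thus "(\<Prod>i\<in>UNIV. spin_transfer q \<rho> (spin_boundary i0 g) (i # x) s)
      = line_denom q \<rho> g x * spin_boundary i0 g x s"
    by (auto simp: spin_boundary_def line_denom_def g[symmetric] mult.commute)
qed (use assms(2) in \<open>simp add: line_denom_def\<close>)

text \<open>The excluded root value is the one at which the partition function of the one-vertex
  ball, \<open>g [] + of_nat q - 1\<close>, vanishes.\<close>

lemma ex_quasi_gibbs_measure_spin_boundary:
  assumes "boundary_law q \<rho> (spin_boundary i0 g) d" and "0 < i0" "i0 < q"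
    and "g [] \<noteq> 1 - of_nat q"
  shows "\<exists>\<mu>. quasi_gibbs_measure q \<rho> (spin_boundary i0 g) \<mu>"
proof (rule ex_quasi_gibbs_measure)
  show "compatible q \<rho> (spin_boundary i0 g)"
    using assms(4) by (intro compatible_boundary_law[OF assms(1)])
      (simp add: sum_spin_boundary[OF assms(3)] eq_diff_eq diff_eq_eq add.commute)
qed (use assms in \<open>auto simp: spin_boundary_def\<close>)

lemma boundary_law_line_boundary:
  assumes "fixed_point_solution q \<rho> x" "i0 < q"
  shows "boundary_law q \<rho> (line_boundary i0 x) (\<lambda>_. (x + \<rho> + of_nat q - 2) ^ 3)"
proof -
  let ?c = "x + \<rho> + of_nat q - 2"
  have c: "?c \<noteq> 0" and x: "x = ((\<rho> * x + of_nat q - 1) / ?c) ^ 3"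
    using assms(1) by (auto simp: fixed_point_solution_def)
  have eq: "x * ?c ^ 3 = (\<rho> * x + of_nat q - 1) ^ 3"
    using c by (subst x) (simp add: power_divide)
  have d: "line_denom q \<rho> (\<lambda>_. x) = (\<lambda>_. ?c ^ 3)"
    by (auto simp: line_denom_def)
  show ?thesis
    using boundary_law_spin_boundary[OF assms(2), where g = "\<lambda>_. x" and \<rho> = \<rho>] c eq
    by (simp add: d line_boundary_eq)
qed

lemma potts_cubic_eq:
  "x ^ 3 - potts_A q \<rho> * x ^ 2 - potts_B q \<rho> * x + potts_C q
     = (x + of_nat q - 1) ^ 3 - (\<rho> - 1) ^ 2 * ((\<rho> + 2) * x ^ 2 + (\<rho> - 4 + 3 * of_nat q) * x)"
  unfolding potts_A_def potts_B_def potts_C_def by (simp add: algebra_simps power2_eq_square power3_eq_cube)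

text \<open>The left side is the fixed point equation with its denominator cleared, so a root of the
  cubic solves that equation once the denominator is nonzero.\<close>

lemma potts_cubic_fixed_point:
  "x * (x + \<rho> + of_nat q - 2) ^ 3 - (\<rho> * x + of_nat q - 1) ^ 3
     = (x - 1) * (x ^ 3 - potts_A q \<rho> * x ^ 2 - potts_B q \<rho> * x + potts_C q)"
  unfolding potts_A_def potts_B_def potts_C_def by (simp add: algebra_simps power2_eq_square power3_eq_cube)

text \<open>
  At \<open>\<rho> = 1\<close> the cubic has the triple root \<open>1 - q\<close>, so its roots are close to \<open>1 - q\<close> when
  \<open>\<rho>\<close> is close to \<open>1\<close>.
\<close>

lemma potts_cubic_root:
  fixes x :: "'p::prime_card padic"
  assumes root: "x ^ 3 - potts_A q \<rho> * x ^ 2 - potts_B q \<rho> * x + potts_C q = 0"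
    and \<rho>: "padic_norm (\<rho> - 1) < 1" "\<rho> \<noteq> 1" and q: "q \<ge> 3"
    and nq: "padic_norm (of_nat q :: 'p padic) = 1"
  shows "padic_norm (x + \<rho> + of_nat q - 2) < 1" "fixed_point_solution q \<rho> x" "x \<noteq> 1 - of_nat q"
proof -
  define Q where "Q = (of_nat q :: 'p padic)"
  define R where "R = (\<rho> + 2) * x ^ 2 + (\<rho> - 4 + 3 * Q) * x"
  have eq: "(x + Q - 1) ^ 3 = (\<rho> - 1) ^ 2 * R"
    using root unfolding potts_cubic_eq by (simp add: Q_def R_def)
  \<comment> \<open>Both coefficients in \<open>R\<close> are \<open>\<rho> - 1\<close> plus an
    integer, namely \<open>3\<close> and \<open>3 * q - 3\<close>.\<close>
  have nint: "padic_norm (\<rho> - 1 + of_int k) \<le> 1" for k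
    using \<rho>(1) padic_norm_of_int_le_1[of k] by (intro padic_norm_add_le) auto
  have n1: "padic_norm (\<rho> + 2) \<le> 1" using nint[of 3] by (simp add: algebra_simps)
  have n2: "padic_norm (\<rho> - 4 + 3 * Q) \<le> 1"
    using nint[of "3 * int q - 3"] by (simp add: Q_def algebra_simps)
  have nQ1: "padic_norm (Q - 1) \<le> 1"
    using padic_norm_of_int_le_1[of "int q - 1"] by (simp add: Q_def)
  have nsq: "padic_norm (\<rho> - 1) ^ 2 < 1" using \<rho>(1) by (simp add: power_less_one_iff)
  \<comment> \<open>For \<open>|x| > 1\<close> the left side of \<open>eq\<close> has norm
    \<open>|x| ^ 3\<close>, because \<open>Q - 1\<close> is integral, whereas the right side has
    norm at most \<open>|x| ^ 2\<close>.\<close>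
  have x1: "padic_norm x \<le> 1"
  proof (rule ccontr)
    assume "\<not> padic_norm x \<le> 1"
    hence x: "padic_norm x > 1" by simp
    have "padic_norm R \<le> padic_norm x ^ 2"
      unfolding R_def
    proof (rule padic_norm_add_le)
      show "padic_norm ((\<rho> + 2) * x\<^sup>2) \<le> padic_norm x ^ 2"
        using n1 by (simp add: mult_left_le_one_le)
      have "padic_norm ((\<rho> - 4 + 3 * Q) * x) \<le> padic_norm x"
        using n2 by (simp add: mult_left_le_one_le)
      also have "\<dots> \<le> padic_norm x ^ 2" using x by (simp add: power2_eq_square)
      finally show "padic_norm ((\<rho> - 4 + 3 * Q) * x) \<le> padic_norm x ^ 2" .
    qed
    hence "padic_norm ((\<rho> - 1) ^ 2 * R) \<le> padic_norm x ^ 2"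
      using nsq mult_mono[of "padic_norm (\<rho> - 1) ^ 2" 1 "padic_norm R" "padic_norm x ^ 2"] by simp
    also have "\<dots> < padic_norm x ^ 3" using x by (intro power_strict_increasing) auto
    also have "\<dots> = padic_norm ((x + Q - 1) ^ 3)"
      using padic_norm_add_eq[of "Q - 1" x] nQ1 x by (simp add: add_diff_eq)
    finally show False using eq by simp
  qed
  have "padic_norm R \<le> 1"
    unfolding R_def using n1 n2 x1
    by (intro padic_norm_add_le) (auto intro!: mult_le_one power_le_one)
  hence "padic_norm ((x + Q - 1) ^ 3) < 1"
    unfolding eq using nsq mult_left_le[of "padic_norm R" "padic_norm (\<rho> - 1) ^ 2"] by simp
  hence y: "padic_norm (x + Q - 1) < 1"
    using one_le_power[of "padic_norm (x + Q - 1)" 3] by fastforce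
  have "padic_norm ((x + Q - 1) + (\<rho> - 1)) < 1"
    by (rule padic_norm_add_less) (use y \<rho>(1) in auto)
  thus "padic_norm (x + \<rho> + of_nat q - 2) < 1"
    by (simp add: Q_def algebra_simps)
  have fp: "x * (x + \<rho> + Q - 2) ^ 3 = (\<rho> * x + Q - 1) ^ 3"
    using potts_cubic_fixed_point[of x \<rho> q] root by (simp add: Q_def)
  \<comment> \<open>If the denominator vanished, \<open>fp\<close> would make the numerator vanish
    too. Modulo the denominator the numerator is \<open>- (\<rho> - 1) * (Q + (\<rho> - 1))\<close>,
    a nonzero number times a unit.\<close>
  have c: "x + \<rho> + Q - 2 \<noteq> 0"
  proof
    assume c: "x + \<rho> + Q - 2 = 0"
    hence "\<rho> * x + Q - 1 = 0" using fp by simp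
    moreover have "\<rho> * x + Q - 1 = \<rho> * (x + \<rho> + Q - 2) - (\<rho> - 1) * (Q + (\<rho> - 1))" by (simp add: algebra_simps power2_eq_square power3_eq_cube)
    ultimately have "Q + (\<rho> - 1) = 0" using c \<rho>(2) by simp
    moreover have "padic_norm (Q + (\<rho> - 1)) = 1"
      using padic_norm_add_eq[of "\<rho> - 1" Q] nq \<rho>(1) by (simp add: Q_def)
    ultimately show False by simp
  qed
  thus "fixed_point_solution q \<rho> x"
    using fp unfolding fixed_point_solution_def Q_def by (simp add: power_divide eq_divide_eq)
  \<comment> \<open>At \<open>1 - q\<close> the cube in \<open>eq\<close> is zero, so
    \<open>R\<close> would have to vanish; but there \<open>R\<close> splits into factors that are
    nonzero for \<open>q \<ge> 3\<close> and \<open>\<rho> \<noteq> 1\<close>.\<close>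
  show "x \<noteq> 1 - of_nat q"
  proof
    assume x: "x = 1 - of_nat q"
    hence "(\<rho> - 1) ^ 2 * R = 0" using eq by (simp add: Q_def)
    hence "R = 0" using \<rho>(2) by simp
    moreover have "R = (\<rho> - 1) * (1 - Q) * (2 - Q)"
      unfolding R_def x Q_def by (simp add: algebra_simps power2_eq_square power3_eq_cube)
    moreover have "Q \<noteq> 1" "Q \<noteq> 2"
      using q of_nat_eq_iff[of q 1, where 'a = "'p padic"] of_nat_eq_iff[of q 2, where 'a = "'p padic"]
      by (auto simp: Q_def)
    ultimately show False using \<rho>(2) by simp
  qed
qed

section \<open>An unbounded measure from three rays\<close>

text \<open>Choices are listed most recent first, so the last entry is the step from the root. It is
  arbitrary and all later steps are \<open>1\<close>, which gives three rays.\<close>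

definition on_ray :: "vertex \<Rightarrow> bool" where
  "on_ray x \<longleftrightarrow> x \<noteq> [] \<and> set (butlast x) \<subseteq> {1}"

text \<open>The root value is the product of the values at its three successors, as the law at the
  root demands. A single ray would give the root the value \<open>1 - q\<close>, for which the
  partition function of the one-vertex ball vanishes.\<close>

definition ray_field :: "nat \<Rightarrow> vertex \<Rightarrow> 'p::prime_card padic" where
  "ray_field q x = (if x = [] then (1 - of_nat q) ^ 3 else if on_ray x then 1 - of_nat q else 1)"

text \<open>Below the root, a vertex on a ray has exactly one successor on a ray and any other
  vertex has none; the successors of the root all lie on rays.\<close>

lemma prod_ray_field:
  "(\<Prod>i\<in>UNIV. ray_field q (i # x)) = (ray_field q x :: 'a::prime_card padic)"
proof (cases "x = []")
  case True
  thus ?thesis by (simp add: ray_field_def on_ray_def)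
next
  case False
  hence "(ray_field q (i # x) :: 'a padic)
      = (if i = 1 then (if on_ray x then 1 - of_nat q else 1) else 1)" for i
    by (auto simp: ray_field_def on_ray_def)
  thus ?thesis using False by (simp add: ray_field_def[of q x])
qed

text \<open>The denominators are \<open>\<rho> - 1\<close> on the rays and units elsewhere. Every
  level has a vertex with a successor on a ray, so \<open>padic_norm (\<rho> - 1)\<close> serves as
  the bound below \<open>1\<close>.\<close>

lemma ray_measure:
  fixes \<rho> :: "'p::prime_card padic"
  assumes \<rho>: "padic_norm (\<rho> - 1) < 1" "\<rho> \<noteq> 1" "padic_norm \<rho> = 1" and q: "q \<ge> 3"
    and nq: "padic_norm (of_nat q :: 'p padic) = 1" and i0: "0 < i0" "i0 < q"
  shows "\<exists>h \<mu>. quasi_gibbs_measure q \<rho> h \<mu> \<and> \<not> padic_bounded (cylinder_algebra q) \<mu>"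
proof -
  define Q where "Q = (of_nat q :: 'p padic)"
  let ?g = "ray_field q :: vertex \<Rightarrow> 'p padic"
  let ?c = "\<lambda>y. ?g y + \<rho> + of_nat q - 2"
  have c: "?c y = (if on_ray y then \<rho> - 1 else Q + (\<rho> - 1))" if "y \<noteq> []" for y
    using that by (simp add: ray_field_def Q_def algebra_simps)
  have w: "padic_norm (Q + (\<rho> - 1)) = 1"
    using padic_norm_add_eq[of "\<rho> - 1" Q] nq \<rho>(1) by (simp add: Q_def)
  have c_le: "padic_norm (?c y) \<le> 1" if "y \<noteq> []" for y
    unfolding c[OF that] using w \<rho>(1) by simp
  have law: "boundary_law q \<rho> (spin_boundary i0 ?g) (line_denom q \<rho> ?g)"
  proof (rule boundary_law_spin_boundary[OF i0(2)])
    show "?c (i # x) \<noteq> 0" for i x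
      using c[of "i # x"] w \<rho>(2) by auto
    \<comment> \<open>Away from the root the field takes only the values \<open>1\<close> and
      \<open>1 - q\<close>, both fixed by the Moebius map; this reduces the law to
      \<open>prod_ray_field\<close>.\<close>
    have "\<rho> * ?g (i # x) + of_nat q - 1 = ?g (i # x) * ?c (i # x)" for i x
      by (simp add: ray_field_def algebra_simps)
    thus "?g x * line_denom q \<rho> ?g x = (\<Prod>i\<in>UNIV. \<rho> * ?g (i # x) + of_nat q - 1)" for x
      by (simp add: line_denom_def prod.distrib prod_ray_field)
  qed
  have "?g [] \<noteq> 1 - of_nat q"
  proof
    assume "?g [] = 1 - of_nat q"
    hence "(1 - Q) ^ 3 - (1 - Q) = 0" by (simp add: ray_field_def Q_def)
    moreover have "(1 - Q) ^ 3 - (1 - Q) = - (1 - Q) * Q * (2 - Q)" by (simp add: algebra_simps power2_eq_square power3_eq_cube)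
    ultimately have "Q = 0 \<or> Q = 1 \<or> Q = 2" by auto
    thus False
      using q of_nat_eq_iff[of q 1, where 'a = "'p padic"] of_nat_eq_iff[of q 2, where 'a = "'p padic"]
      by (auto simp: Q_def)
  qed
  from ex_quasi_gibbs_measure_spin_boundary[OF law i0 this]
  obtain \<mu> where \<mu>: "quasi_gibbs_measure q \<rho> (spin_boundary i0 ?g) \<mu>" ..
  have "\<not> padic_bounded (cylinder_algebra q) \<mu>"
  proof (rule not_padic_bounded_boundary_law[OF \<mu> law _ \<rho>(3) _ _ \<rho>(1)])
    show "padic_norm (line_denom q \<rho> ?g x) \<le> 1" for x
      unfolding line_denom_def padic_norm_prod by (rule prod_le_1) (use c_le in auto)
    show "\<exists>x\<in>tree_level m. padic_norm (line_denom q \<rho> ?g x) \<le> padic_norm (\<rho> - 1)" for m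
    proof
      \<comment> \<open>This vertex of level \<open>m\<close> has the ray vertex
        \<open>1 # ?x\<close> as a successor, and that one factor already has norm
        \<open>padic_norm (\<rho> - 1)\<close>.\<close>
      let ?x = "replicate m 1 :: vertex"
      have "set (butlast (1 # ?x)) \<subseteq> set (1 # ?x)" by (meson in_set_butlastD subsetI)
      also have "\<dots> \<subseteq> {1}" by auto
      finally have "on_ray (1 # ?x)" by (simp add: on_ray_def)
      moreover have "padic_norm (line_denom q \<rho> ?g ?x) \<le> padic_norm (?c (1 # ?x))"
        unfolding line_denom_def padic_norm_prod by (rule prod_le_factor) (use c_le in auto)
      ultimately show "padic_norm (line_denom q \<rho> ?g ?x) \<le> padic_norm (\<rho> - 1)"
        using c[of "1 # ?x"] by simp
    qed simp
  qed (use q in simp)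
  thus ?thesis using \<mu> by blast
qed

theorem theorem5p2:
  fixes \<rho> :: "'p::prime_card padic"
    and p q i0 :: nat
    and a0 b0 D0 :: int
    and u :: "nat \<Rightarrow> int"
  assumes p_card: "p = CARD('p)"
    and p_gt_3: "p > 3"
    and q_ge_3: "q \<ge> 3"
    and norm_q: "padic_norm (of_nat q :: 'p padic) = 1"
    and norm_q1: "padic_norm (of_nat q - 1 :: 'p padic) = 1"
    and norm_2q1: "padic_norm (2 * of_nat q - 1 :: 'p padic) = 1"
    and i0: "i0 \<in> {1..q - 1}"
    and rho_E: "\<rho> \<in> padic_E"
    and rho_ne_1: "\<rho> \<noteq> 1"
    and rho_p3: "padic_norm (\<rho> - 1) \<le> 1 / real p ^ 3"
    and rho_4q3: "padic_norm (\<rho> - 1) < padic_norm (4 * of_nat q - 3 :: 'p padic)"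
    and a0: "a0 \<in> {1..int p - 1}" "[a0 = 3 * (int q - 1)] (mod int p)"
    and b0: "b0 \<in> {1..int p - 1}" "[b0 = 2 * (int q - 1) * (2 * int q - 1)] (mod int p)"
    and D0: "D0 = - 4 * a0 ^ 3 - 27 * b0 ^ 2"
    and u_init: "u 1 = 0" "u 2 = - a0" "u 3 = b0"
    and u_rec: "\<And>n. n \<ge> 1 \<Longrightarrow> u (n + 3) = b0 * u n - a0 * u (n + 1)"
    and conditions:
      "(padic_norm (4 * of_nat q - 3 :: 'p padic) = 1 \<and> [u (p - 2) = 0] (mod int p))
       \<or> (\<exists>k\<ge>1. padic_norm (4 * of_nat q - 3 :: 'p padic) = 1 / real p ^ (2 * k) \<and>
            QuadRes (int p)
              (- 108 * int q * (int q - 1) ^ 2 * ((4 * int q - 3) div int p ^ (2 * k))))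
       \<or> (\<not> [D0 * u (p - 2) ^ 2 = 0] (mod int p)
            \<and> \<not> [D0 * u (p - 2) ^ 2 = 9 * a0 ^ 2] (mod int p))
       \<or> (\<exists>k\<ge>0. padic_norm (4 * of_nat q - 3 :: 'p padic) = 1 / real p ^ (2 * k + 1))
       \<or> (\<exists>k\<ge>1. padic_norm (4 * of_nat q - 3 :: 'p padic) = 1 / real p ^ (2 * k) \<and>
            \<not> QuadRes (int p)
              (- 108 * int q * (int q - 1) ^ 2 * ((4 * int q - 3) div int p ^ (2 * k))))"
  shows "(\<exists>\<mu>0. corresponding_measure q \<rho> i0 1 \<mu>0)
    \<and> (\<forall>\<mu>0. corresponding_measure q \<rho> i0 1 \<mu>0 \<longrightarrow>
          gibbs_measure q \<rho> (line_boundary i0 1) \<mu>0 \<and> padic_bounded (cylinder_algebra q) \<mu>0)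
    \<and> (\<forall>x. x ^ 3 - potts_A q \<rho> * x ^ 2 - potts_B q \<rho> * x + potts_C q = 0 \<longrightarrow>
          (\<exists>\<mu>. corresponding_measure q \<rho> i0 x \<mu>) \<and>
          (\<forall>\<mu>. corresponding_measure q \<rho> i0 x \<mu> \<longrightarrow> \<not> padic_bounded (cylinder_algebra q) \<mu>))
    \<and> phase_transition q \<rho>"
proof -
  have \<rho>: "padic_norm (\<rho> - 1) < 1" "padic_norm \<rho> = 1"
  proof -
    have "1 / real p ^ 3 < 1" using p_gt_3 by (simp add: one_less_power)
    thus "padic_norm (\<rho> - 1) < 1" using rho_p3 by linarith
  qed (use rho_E in \<open>simp add: padic_E_def\<close>)
  have i0': "0 < i0" "i0 < q" using i0 q_ge_3 by auto
  have measure: "\<exists>\<mu>. corresponding_measure q \<rho> i0 x \<mu>"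
    if "fixed_point_solution q \<rho> x" "x \<noteq> 1 - of_nat q" for x
    using ex_quasi_gibbs_measure_spin_boundary[of q \<rho> i0 "\<lambda>_. x"] boundary_law_line_boundary[OF that(1) i0'(2)]
      i0' that by (auto simp: corresponding_measure_def line_boundary_eq)

  \<comment> \<open>This is the denominator at the solution \<open>1\<close>: the unit
    \<open>q\<close> plus the small number \<open>\<rho> - 1\<close>.\<close>
  have c: "padic_norm (\<rho> + of_nat q - 1) = 1"
    using padic_norm_add_eq[of "\<rho> - 1" "of_nat q :: 'p padic"] norm_q \<rho>(1) by (simp add: algebra_simps)
  hence c0: "\<rho> + of_nat q - 1 \<noteq> 0" by auto
  have c': "1 + \<rho> + of_nat q - 2 = \<rho> + of_nat q - 1" by simp
  have fp: "fixed_point_solution q \<rho> 1"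
    using c0 unfolding fixed_point_solution_def c' by simp
  \<comment> \<open>Every weight has norm \<open>1\<close>, and so has every partition function: the
    one-vertex ball contributes \<open>q\<close>, and each further vertex the cube of a
    unit.\<close>
  have bounded: "padic_bounded (cylinder_algebra q) \<mu>"
    if \<mu>: "quasi_gibbs_measure q \<rho> (line_boundary i0 1) \<mu>" for \<mu>
  proof (rule padic_bounded_quasi_gibbs_measure[OF \<mu>])
    fix n \<sigma>
    have "padic_norm (partition_function q \<rho> (line_boundary i0 1) n) = 1"
      unfolding partition_function_eq[OF boundary_law_line_boundary[OF fp i0'(2)]] c'
      using c norm_q by (simp add: padic_norm_prod line_boundary_eq sum_spin_boundary[OF i0'(2)])
    thus "padic_norm (finite_volume_measure q \<rho> (line_boundary i0 1) n \<sigma>) \<le> 1"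
      by (simp add: finite_volume_measure_def gibbs_weight_def line_boundary_def \<rho>(2) padic_norm_prod)
  qed simp
  \<comment> \<open>All boundary values are \<open>1\<close>, which lies in \<open>padic_E\<close>
    because its radius is positive.\<close>
  have gibbs: "gibbs_measure q \<rho> (line_boundary i0 1) \<mu>"
    if "quasi_gibbs_measure q \<rho> (line_boundary i0 1) \<mu>" for \<mu>
    using that rho_E prime_gt_0_nat[OF prime_card[where 'a='p]]
    by (simp add: gibbs_measure_def line_boundary_def padic_E_def)
  have "\<exists>\<mu>0. corresponding_measure q \<rho> i0 1 \<mu>0"
    using q_ge_3 by (intro measure fp) auto

  moreover have "(\<exists>\<mu>. corresponding_measure q \<rho> i0 x \<mu>) \<and>
      (\<forall>\<mu>. corresponding_measure q \<rho> i0 x \<mu> \<longrightarrow> \<not> padic_bounded (cylinder_algebra q) \<mu>)"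
    if root: "x ^ 3 - potts_A q \<rho> * x ^ 2 - potts_B q \<rho> * x + potts_C q = 0" for x
  proof (intro conjI allI impI)
    note x = potts_cubic_root[OF root \<rho>(1) rho_ne_1 q_ge_3 norm_q]
    show "\<exists>\<mu>. corresponding_measure q \<rho> i0 x \<mu>"
      by (rule measure[OF x(2,3)])
    fix \<mu> assume "corresponding_measure q \<rho> i0 x \<mu>"
    hence \<mu>: "quasi_gibbs_measure q \<rho> (line_boundary i0 x) \<mu>"
      by (simp add: corresponding_measure_def)
    have d: "padic_norm ((x + \<rho> + of_nat q - 2) ^ 3) < 1"
      using x(1) by (simp add: power_less_one_iff)
    show "\<not> padic_bounded (cylinder_algebra q) \<mu>"
    proof (rule not_padic_bounded_boundary_law[OF \<mu> boundary_law_line_boundary[OF x(2) i0'(2)] _ \<rho>(2) _ _ d])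
      show "\<exists>y\<in>tree_level m. padic_norm ((x + \<rho> + of_nat q - 2) ^ 3)
          \<le> padic_norm ((x + \<rho> + of_nat q - 2) ^ 3)" for m
        by (rule bexI[of _ "replicate m 1"]) auto
    qed (use d q_ge_3 in auto)
  qed
  moreover have "phase_transition q \<rho>"
  proof -
    obtain \<mu>0 where \<mu>0: "quasi_gibbs_measure q \<rho> (line_boundary i0 1) \<mu>0"
      using \<open>\<exists>\<mu>0. corresponding_measure q \<rho> i0 1 \<mu>0\<close> by (auto simp: corresponding_measure_def)
    obtain h \<mu> where \<mu>: "quasi_gibbs_measure q \<rho> h \<mu>" "\<not> padic_bounded (cylinder_algebra q) \<mu>"
      using ray_measure[OF \<rho>(1) rho_ne_1 \<rho>(2) q_ge_3 norm_q i0'] by blast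
    \<comment> \<open>Boundedness depends only on the values on the algebra, so a bounded and an
      unbounded measure must differ there.\<close>
    have "\<exists>A\<in>cylinder_algebra q. \<mu>0 A \<noteq> \<mu> A"
    proof (rule ccontr)
      assume "\<not> ?thesis"
      hence "(\<lambda>A. padic_norm (\<mu>0 A)) ` cylinder_algebra q = (\<lambda>A. padic_norm (\<mu> A)) ` cylinder_algebra q"
        by (intro image_cong) auto
      thus False using bounded[OF \<mu>0] \<mu>(2) by (simp add: padic_bounded_def)
    qed
    thus ?thesis using \<mu>0 \<mu> unfolding phase_transition_def by blast
  qed
  ultimately show ?thesis
    using bounded gibbs by (auto simp: corresponding_measure_def)
qed

end
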